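(* Let $s,L,M>0$ be fixed, $m\le n$, and suppose that $$\big(n\log_2(n)/m^{2+2s}\big)^{1/(1+2s)}\vee\log_2 n\ \le\ B\ <\ n^{1/(1+2s)}/\log_2 n$$ ($m$ and $B$ may depend on $n$). Put $\eta=\big\lfloor (L^2n)^{\frac1{2+2s}}\big((\log_2 n)/B\big)^{\frac{1+2s}{2+2s}}\big\rfloor\wedge m$ and $\mu_{jk}=\big\lceil(2^j+k)\lfloor B/\log_2 n\rfloor^{-1}\big\rceil-1$. Let $\hat f$ be the following distributed estimator: for $\ell=1,\dots,\eta$, each machine $i$ with $\lfloor(\ell-1)m/\eta\rfloor+1\le i\le\lfloor\ell m/\eta\rfloor$ transmits $Y^{(i)}_{jk}=\mathrm{TransApprox}(\hat f^{(i)}_{jk})$ for all $(j,k)$ with $(\ell-1)\lfloor B/\log_2 n\rfloor<2^j+k\le\ell\lfloor B/\log_2 n\rfloor$; the central machine forms $\hat f=\sum_{j,k}\hat f_{jk}\psi_{jk}$, where $\hat f_{jk}$ is the average of $\{Y^{(i)}_{jk}:\ \mu_{jk}m/\eta<i\le(\mu_{jk}+1)m/\eta\}$ if $2^j+k\le\eta\lfloor B/\log_2 n\rfloor$, and $\hat f_{jk}=0$ otherwise. Then (for $n$ large enough) $\hat f\in\mathcal F_{dist}(B,\dots,B;B^s_{2,\infty}(L))$ and $$\sup_{f_0\in B^s_{2,\infty}(L),\ \|f_0\|_\infty\le M}\mathbb E_{f_0,T}\|\hat f-f_0\|_2^2\ \lesssim\ M_n\Big(\frac{n^{1/(1+2s)}}{B\log_2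 n}\Big)^{\frac{2s}{2+2s}}n^{-\frac{2s}{1+2s}},\qquad M_n=L^{\frac4{2+2s}}(\log_2 n)^{2s}.$$
   Context: Model. The total sample size is $n$ and there are $m=m_n$ local machines with $n/m\in\mathbb N$. Machine $i\in\{1,\dots,m\}$ observes pairs $(T^{(i)}_\ell,X^{(i)}_\ell)$, $\ell=1,\dots,n/m$, with $X^{(i)}_\ell=f_0(T^{(i)}_\ell)+\sigma\varepsilon^{(i)}_\ell$, where the $T^{(i)}_\ell$ are iid uniform on $(0,1)$, the $\varepsilon^{(i)}_\ell$ are iid $N(0,1)$, independent of the design, $\sigma>0$ is fixed and $f_0\in L_2[0,1]$ is unknown and common to all machines. $\mathbb E_{f_0,T}$ is expectation under the joint law of all data. Distributed estimators. Machine $i$ sends to a central machine a finite binary string $Y^{(i)}$ which is a measurable function of its local data; $l(Y)$ denotes the length of a string $Y$. For $\mathcal F\subset L_2[0,1]$, $\mathcal F_{dist}(B^{(1)},\dots,B^{(m)};\mathcal F)$ is the class of estimators $\hat f$ that are measurable functions of $(Y^{(1)},\dots,Y^{(m)})$ for such strings satisfying $\mathbb E_{f_0,T}[l(Y^{(i)})]\le B^{(i)}$ for all $f_0\in\mathcal F$ and all $i$. Wavelets and Besov balls. $\psi_{jk}$ ($j\ge 0$, $0\le k\le 2^j-1$) is a Cohen–Daubechies–Vial compactly supported orthonormal wavelet basis of $L_2[0,1]$ with $N>s$ vanishing moments (coarsest-level scaling functions included in the indexing), $f_{jk}=\langle f,\psi_{jk}\rangle$, $\|f\|_{B^s_{2,\infty}}^2=\sup_{j}2^{2js}\sum_{k=0}^{2^j-1}f_{jk}^2$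 and $B^s_{2,\infty}(L)=\{f\in L_2[0,1]:\|f\|_{B^s_{2,\infty}}<L\}$. Local estimators: $\hat f^{(i)}_{jk}=\frac mn\sum_{\ell=1}^{n/m}X^{(i)}_\ell\psi_{jk}(T^{(i)}_\ell)$. TransApprox. For $x\in\mathbb R$ with binary expansion $|x|=\sum_{k=-\infty}^{\lfloor\log_2|x|\rfloor}b_k2^k$, $b_k\in\{0,1\}$, $\mathrm{TransApprox}(x)$ transmits the sign bit of $x$ and the digits $b_k$ with $-D\log_2 n\le k\le\log_2|x|$, where $D=1/2$; this encodes the number $y$ having the same sign as $x$ and $|y|=\sum_{-D\log_2 n\le k\le\log_2|x|}b_k2^k$. Its length in bits is at most $1+(1\vee\log_2|x|)+D\log_2 n$. The symbol $Y^{(i)}_{jk}$ is used both for the bit string and for the number $y$ it encodes. Notation. $a\wedge b=\min(a,b)$, $a\vee b=\max(a,b)$. For positive sequences, $a_n\lesssim b_n$ means $a_n\le Cb_n$ for all sufficiently large $n$ with a constant $C>0$ not depending on $n$ (it may depend on fixed quantities such as $s,L,M,\sigma$ and the wavelet basis). *)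

theory Defs
  imports "HOL-Probability.Probability"
begin

section \<open>The space $L_2[0,1]$\<close>

text \<open>Elements are represented by Borel functions on the real line; only their values on the
  unit interval matter.\<close>

definition L2_unit :: "(real \<Rightarrow> real) set" where
  "L2_unit = {f \<in> borel_measurable borel. set_integrable lborel {0..1} (\<lambda>x. (f x)\<^sup>2)}"

definition inner_unit :: "(real \<Rightarrow> real) \<Rightarrow> (real \<Rightarrow> real) \<Rightarrow> real" where
  "inner_unit f g = (LINT x:{0..1}|lborel. f x * g x)"

text \<open>Orthonormal bases indexed by the pairs $(j,k)$ with $k < 2^j$.\<close>

definition orthonormal_basis_unit :: "(nat \<Rightarrow> nat \<Rightarrow> real \<Rightarrow> real) \<Rightarrow> bool" where
  "orthonormal_basis_unit \<psi> \<longleftrightarrow>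
     (\<forall>j. \<forall>k<2^j. \<psi> j k \<in> L2_unit) \<and>
     (\<forall>j j'. \<forall>k<2^j. \<forall>k'<2^j'.
        inner_unit (\<psi> j k) (\<psi> j' k') = (if j = j' \<and> k = k' then 1 else 0)) \<and>
     (\<forall>f\<in>L2_unit.
        (\<lambda>J. LINT x:{0..1}|lborel.
               (f x - (\<Sum>j<J. \<Sum>k<2^j. inner_unit f (\<psi> j k) * \<psi> j k x))\<^sup>2)
          \<longlonglongrightarrow> 0)"

section \<open>Cohen--Daubechies--Vial wavelets\<close>

text \<open>Father and mother wavelet of Daubechies with $N$ vanishing moments and a filter of length
  $2N$, translated so that both are supported in $[1-N,N]$.  The case $N=1$ is the Haar
  wavelet.\<close>

definition daubechies_pair :: "nat \<Rightarrow> (real \<Rightarrow> real) \<Rightarrow> (real \<Rightarrow> real) \<Rightarrow> bool" where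
  "daubechies_pair N \<phi> \<omega> \<longleftrightarrow>
     \<phi> \<in> borel_measurable borel \<and>
     integrable lborel (\<lambda>x. (\<phi> x)\<^sup>2) \<and>
     (\<forall>x. x \<notin> {1 - real N..real N} \<longrightarrow> \<phi> x = 0) \<and>
     (LINT x|lborel. \<phi> x) = 1 \<and>
     (\<forall>l::int. (LINT x|lborel. \<phi> x * \<phi> (x - of_int l)) = (if l = 0 then 1 else 0)) \<and>
     (\<exists>h :: int \<Rightarrow> real.
        (AE x in lborel. \<phi> x = sqrt 2 * (\<Sum>n=1 - int N..int N. h n * \<phi> (2 * x - of_int n))) \<and>
        (\<forall>x. \<omega> x = sqrt 2 *
           (\<Sum>n=1 - int N..int N. (-1) powi n * h (1 - n) * \<phi> (2 * x - of_int n)))) \<and>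
     (\<forall>p<N. (LINT x|lborel. x ^ p * \<omega> x) = 0)"

text \<open>The functions $\sum_{n=r}^{2N-2} {n \choose r} \varphi(x+n-N+1)$ on $[0,\infty)$, and their
  mirror images on $(-\infty,0]$, whose spans are the edge spaces of Cohen, Daubechies and Vial:
  together with the interior translates of $\varphi$ they generate all polynomials of degree below
  $N$.\<close>

definition left_edge :: "nat \<Rightarrow> (real \<Rightarrow> real) \<Rightarrow> nat \<Rightarrow> real \<Rightarrow> real" where
  "left_edge N \<phi> r x = (if 0 \<le> x
     then \<Sum>n=r..2*N-2. real (n choose r) * \<phi> (x + real n - real N + 1) else 0)"

definition right_edge :: "nat \<Rightarrow> (real \<Rightarrow> real) \<Rightarrow> nat \<Rightarrow> real \<Rightarrow> real" where
  "right_edge N \<phi> r x = (if x \<le> 0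
     then \<Sum>n=r..2*N-2. real (n choose r) * \<phi> (x - real n + real N) else 0)"

text \<open>The $2^j$ functions of level $j$ on $[0,1]$: $N$ at the left edge, $2^j-2N$ interior
  translates of \<open>g\<close>, $N$ at the right edge.\<close>

definition cdv_level ::
  "nat \<Rightarrow> (nat \<Rightarrow> real \<Rightarrow> real) \<Rightarrow> (real \<Rightarrow> real) \<Rightarrow> (nat \<Rightarrow> real \<Rightarrow> real) \<Rightarrow> nat \<Rightarrow> nat \<Rightarrow> real \<Rightarrow> real"
  where
  "cdv_level N gl g gr j k x = 2 powr (real j / 2) *
     (if k < N then gl k (2^j * x)
      else if k < 2^j - N then g (2^j * x - real k)
      else gr (2^j - 1 - k) (2^j * (x - 1)))"

text \<open>The scaling functions \<open>\<phi>l\<close>, \<open>\<phi>r\<close> and the wavelets \<open>\<omega>l\<close>, \<open>\<omega>r\<close> at the edges result from an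
  orthonormalisation, in the edge spaces and in the orthogonal complement of one resolution space in
  the next.  It is not fixed here which one; orthonormality is part of
  \<^const>\<open>orthonormal_basis_unit\<close>.

  The basis consists of the $2^{j_0}$ scaling functions of the coarsest level $j_0$ and, for every
  $j \ge j_0$, the $2^j$ wavelets of level $j$.  As the map $(j,k) \mapsto 2^j+k$ is a bijection onto
  the positive integers, the index set has room for exactly $2^{j_0}-1$ functions below level $j_0$,
  one less than the number of scaling functions.  So the functions are listed along $2^j+k$ by
  increasing resolution: scaling functions for $2^j+k \le 2^{j_0}$, then the wavelets of level
  $i \ge j_0$ for $2^i < 2^j+k \le 2^{i+1}$, in any order within these blocks.\<close>

definition cdv_basis :: "nat \<Rightarrow> (nat \<Rightarrow> nat \<Rightarrow> real \<Rightarrow> real) \<Rightarrow> bool" where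
  "cdv_basis N \<psi> \<longleftrightarrow> orthonormal_basis_unit \<psi> \<and>
     (\<exists>\<phi> \<omega> \<phi>l \<phi>r \<omega>l \<omega>r j0.
        daubechies_pair N \<phi> \<omega> \<and> 2 * N \<le> 2 ^ j0 \<and>
        (\<forall>k<N. \<exists>a. \<forall>x. \<phi>l k x = (\<Sum>r<N. a r * left_edge N \<phi> r x)) \<and>
        (\<forall>k<N. \<exists>a. \<forall>x. \<phi>r k x = (\<Sum>r<N. a r * right_edge N \<phi> r x)) \<and>
        (\<forall>k<N. \<exists>a b. \<forall>x. \<omega>l k x = (\<Sum>r<N. a r * \<phi>l r (2 * x)) +
            (\<Sum>l=N..3*N-2. b l * \<phi> (2 * x - real l))) \<and>
        (\<forall>k<N. \<exists>a b. \<forall>x. \<omega>r k x = (\<Sum>r<N. a r * \<phi>r r (2 * x)) +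
            (\<Sum>l=N..3*N-2. b l * \<phi> (2 * x + real l + 1))) \<and>
        {\<psi> j k | j k. k < 2^j \<and> 2^j + k \<le> 2^j0} = cdv_level N \<phi>l \<phi> \<phi>r j0 ` {..<2^j0} \<and>
        (\<forall>i\<ge>j0. {\<psi> j k | j k. k < 2^j \<and> 2^i < 2^j + k \<and> 2^j + k \<le> 2^(i+1)}
                  = cdv_level N \<omega>l \<omega> \<omega>r i ` {..<2^i}))"

section \<open>Besov balls\<close>

definition besov_norm_sq :: "(nat \<Rightarrow> nat \<Rightarrow> real \<Rightarrow> real) \<Rightarrow> real \<Rightarrow> (real \<Rightarrow> real) \<Rightarrow> ennreal" where
  "besov_norm_sq \<psi> s f =
     (SUP j. ennreal (2 powr (2 * real j * s) * (\<Sum>k<2^j. (inner_unit f (\<psi> j k))\<^sup>2)))"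

definition besov_ball :: "(nat \<Rightarrow> nat \<Rightarrow> real \<Rightarrow> real) \<Rightarrow> real \<Rightarrow> real \<Rightarrow> (real \<Rightarrow> real) set" where
  "besov_ball \<psi> s L = {f \<in> L2_unit. besov_norm_sq \<psi> s f < ennreal (L\<^sup>2)}"

section \<open>Distributed regression\<close>

text \<open>Local data are families $(T_\ell,X_\ell)$ with $1 \le \ell \le n/m$, and the full data are
  indexed by the machines $1,\dots,m$.\<close>

type_synonym local_data = "nat \<Rightarrow> real \<times> real"

definition local_space :: "nat \<Rightarrow> nat \<Rightarrow> local_data measure" where
  "local_space n m = (\<Pi>\<^sub>M l\<in>{1..n div m}. borel \<Otimes>\<^sub>M borel)"

definition obs_law :: "real \<Rightarrow> (real \<Rightarrow> real) \<Rightarrow> (real \<times> real) measure" where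
  "obs_law \<sigma> f0 = distr
     (uniform_measure lborel {0<..<1} \<Otimes>\<^sub>M density lborel std_normal_density)
     (borel \<Otimes>\<^sub>M borel) (\<lambda>(t, e). (t, f0 t + \<sigma> * e))"

definition data_law :: "nat \<Rightarrow> nat \<Rightarrow> real \<Rightarrow> (real \<Rightarrow> real) \<Rightarrow> (nat \<Rightarrow> local_data) measure" where
  "data_law n m \<sigma> f0 = (\<Pi>\<^sub>M i\<in>{1..m}. \<Pi>\<^sub>M l\<in>{1..n div m}. obs_law \<sigma> f0)"

definition dist_estimators ::
  "nat \<Rightarrow> nat \<Rightarrow> real \<Rightarrow> (nat \<Rightarrow> real) \<Rightarrow> (real \<Rightarrow> real) set
     \<Rightarrow> ((nat \<Rightarrow> local_data) \<Rightarrow> real \<Rightarrow> real) set" where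
  "dist_estimators n m \<sigma> Bs F = {fh.
     \<exists>(Y :: nat \<Rightarrow> local_data \<Rightarrow> bool list) (g :: (nat \<Rightarrow> bool list) \<Rightarrow> real \<Rightarrow> real).
       (\<forall>i\<in>{1..m}. Y i \<in> local_space n m \<rightarrow>\<^sub>M count_space UNIV) \<and>
       (\<lambda>(y, x). g y x) \<in> borel_measurable ((\<Pi>\<^sub>M i\<in>{1..m}. count_space UNIV) \<Otimes>\<^sub>M borel) \<and>
       (\<forall>y\<in>space (\<Pi>\<^sub>M i\<in>{1..m}. count_space UNIV). g y \<in> L2_unit) \<and>
       (\<forall>z\<in>space (\<Pi>\<^sub>M i\<in>{1..m}. local_space n m). fh z = g (\<lambda>i\<in>{1..m}. Y i (z i))) \<and>
       (\<forall>f0\<in>F. \<forall>i\<in>{1..m}.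
          (\<integral>\<^sup>+z. ennreal (real (length (Y i (z i)))) \<partial>data_law n m \<sigma> f0) \<le> ennreal (Bs i))}"

section \<open>TransApprox\<close>

definition trans_cutoff :: "nat \<Rightarrow> int" where
  "trans_cutoff n = \<lfloor>(1/2) * log 2 (real n)\<rfloor>"

text \<open>The bit string is the sign bit followed by the binary digits of $|x|$, least significant
  first.  The digit belonging to $2^k$ is the parity of $\lfloor |x|/2^k \rfloor$.\<close>

definition trans_approx :: "nat \<Rightarrow> real \<Rightarrow> bool list" where
  "trans_approx n x = (x < 0) #
     map (\<lambda>k. odd \<lfloor>\<bar>x\<bar> / 2 powi k\<rfloor>) [- trans_cutoff n..\<lfloor>log 2 \<bar>x\<bar>\<rfloor>]"

definition trans_value :: "nat \<Rightarrow> bool list \<Rightarrow> real" where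
  "trans_value n bs = (case bs of [] \<Rightarrow> 0 | b # ds \<Rightarrow> (if b then -1 else 1) *
     (\<Sum>r<length ds. of_bool (ds ! r) * 2 powi (int r - trans_cutoff n)))"

lemma trans_value_trans_approx:
  "trans_value n (trans_approx n x) = (if x < 0 then -1 else 1) *
     (\<Sum>k | - (1/2) * log 2 (real n) \<le> of_int k \<and> of_int k \<le> log 2 \<bar>x\<bar>.
        of_bool (odd \<lfloor>\<bar>x\<bar> / 2 powi k\<rfloor>) * 2 powi k)"
proof -
  define c where "c = trans_cutoff n"
  define u where "u = \<lfloor>log 2 \<bar>x\<bar>\<rfloor>"
  have set: "{k. - (1/2) * log 2 (real n) \<le> of_int k \<and> of_int k \<le> log 2 \<bar>x\<bar>} = {-c..u}"
    unfolding c_def u_def trans_cutoff_def by (auto; linarith)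
  have "(\<Sum>r<length [-c..u]. of_bool (map (\<lambda>k. odd \<lfloor>\<bar>x\<bar> / 2 powi k\<rfloor>) [-c..u] ! r) * 2 powi (int r - c))
      = (\<Sum>r<nat (u + c + 1). of_bool (odd \<lfloor>\<bar>x\<bar> / 2 powi (int r - c)\<rfloor>) * (2::real) powi (int r - c))"
    by (rule sum.cong) (auto simp: nth_upto algebra_simps)
  also have "\<dots> = (\<Sum>k\<in>{-c..u}. of_bool (odd \<lfloor>\<bar>x\<bar> / 2 powi k\<rfloor>) * 2 powi k)"
    by (rule sum.reindex_bij_witness[of _ "\<lambda>k. nat (k + c)" "\<lambda>r. int r - c"]) auto
  finally show ?thesis
    unfolding set trans_value_def trans_approx_def c_def[symmetric] u_def[symmetric]
    by (simp only: list.case length_map)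
qed

section \<open>The estimator\<close>

definition local_coeff ::
  "(nat \<Rightarrow> nat \<Rightarrow> real \<Rightarrow> real) \<Rightarrow> nat \<Rightarrow> nat \<Rightarrow> local_data \<Rightarrow> nat \<Rightarrow> nat \<Rightarrow> real" where
  "local_coeff \<psi> n m z j k =
     real m / real n * (\<Sum>l=1..n div m. snd (z l) * \<psi> j k (fst (z l)))"

definition block_size :: "nat \<Rightarrow> real \<Rightarrow> nat" where
  "block_size n B = nat \<lfloor>B / log 2 (real n)\<rfloor>"

definition num_groups :: "real \<Rightarrow> real \<Rightarrow> nat \<Rightarrow> nat \<Rightarrow> real \<Rightarrow> nat" where
  "num_groups s L n m B = min
     (nat \<lfloor>(L\<^sup>2 * real n) powr (1 / (2 + 2 * s)) *
           (log 2 (real n) / B) powr ((1 + 2 * s) / (2 + 2 * s))\<rfloor>) m"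

definition group_index :: "nat \<Rightarrow> real \<Rightarrow> nat \<Rightarrow> nat \<Rightarrow> int" where
  "group_index n B j k = \<lceil>(2 ^ j + real k) / real (block_size n B)\<rceil> - 1"

text \<open>What machine \<open>i\<close> with local data \<open>z\<close> transmits about the coefficient $(j,k)$; the empty
  string stands for no transmission.\<close>

definition message ::
  "(nat \<Rightarrow> nat \<Rightarrow> real \<Rightarrow> real) \<Rightarrow> real \<Rightarrow> real \<Rightarrow> nat \<Rightarrow> nat \<Rightarrow> real
     \<Rightarrow> nat \<Rightarrow> local_data \<Rightarrow> nat \<Rightarrow> nat \<Rightarrow> bool list" where
  "message \<psi> s L n m B i z j k =
     (let \<eta> = num_groups s L n m B; b = block_size n B in
      if \<exists>l\<in>{1..\<eta>}. \<lfloor>real (l - 1) * real m / real \<eta>\<rfloor> + 1 \<le> int i \<and>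
                     int i \<le> \<lfloor>real l * real m / real \<eta>\<rfloor> \<and>
                     (l - 1) * b < 2^j + k \<and> 2^j + k \<le> l * b
      then trans_approx n (local_coeff \<psi> n m z j k) else [])"

definition central_coeff ::
  "(nat \<Rightarrow> nat \<Rightarrow> real \<Rightarrow> real) \<Rightarrow> real \<Rightarrow> real \<Rightarrow> nat \<Rightarrow> nat \<Rightarrow> real
     \<Rightarrow> (nat \<Rightarrow> local_data) \<Rightarrow> nat \<Rightarrow> nat \<Rightarrow> real" where
  "central_coeff \<psi> s L n m B z j k =
     (let \<eta> = num_groups s L n m B; \<mu> = of_int (group_index n B j k);
          I = {i\<in>{1..m}. \<mu> * real m / real \<eta> < real i \<and> real i \<le> (\<mu> + 1) * real m / real \<eta>} in
      if 2^j + k \<le> \<eta> * block_size n B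
      then (\<Sum>i\<in>I. trans_value n (message \<psi> s L n m B i (z i) j k)) / real (card I)
      else 0)"

text \<open>The series over all $(j,k)$, restricted to the finitely many terms that are not zero by
  definition.\<close>

definition dist_estimator ::
  "(nat \<Rightarrow> nat \<Rightarrow> real \<Rightarrow> real) \<Rightarrow> real \<Rightarrow> real \<Rightarrow> nat \<Rightarrow> nat \<Rightarrow> real
     \<Rightarrow> (nat \<Rightarrow> local_data) \<Rightarrow> real \<Rightarrow> real" where
  "dist_estimator \<psi> s L n m B z x =
     (\<Sum>(j, k) | k < 2^j \<and> 2^j + k \<le> num_groups s L n m B * block_size n B.
        central_coeff \<psi> s L n m B z j k * \<psi> j k x)"

definition risk ::
  "nat \<Rightarrow> nat \<Rightarrow> real \<Rightarrow> ((nat \<Rightarrow> local_data) \<Rightarrow> real \<Rightarrow> real) \<Rightarrow> (real \<Rightarrow> real) \<Rightarrow> ennreal" where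
  "risk n m \<sigma> fh f0 =
     (\<integral>\<^sup>+z. (\<integral>\<^sup>+x\<in>{0..1}. ennreal ((fh z x - f0 x)\<^sup>2) \<partial>lborel) \<partial>data_law n m \<sigma> f0)"

end

theory Submission imports Defs begin

text \<open>Each of the $\eta$ groups of machines sends its own block of $b = \lfloor B/\log_2 n\rfloor$
  coefficients, so $\eta b$ coefficients are estimated, each by averaging over at least $m/(2\eta)$
  machines, i.e. over $n/(2\eta)$ observations.  As $f_0$ is bounded, the stochastic error of one
  coefficient is of order $\eta/n$, and truncation of the binary digits adds only $4/n$.  The Besov
  condition bounds the omitted coefficients by a multiple of $L^2 (\eta b)^{-2s}$.  The choice of
  $\eta$ balances $\eta^2 b/n$ with this bias up to logarithms; the lower bound on $B$ ensures that
  the cap $\eta \le m$ costs at most the factor $(\log_2 n)^{2s/(2+2s)}$ in $\eta$.\<close>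

section \<open>Binary expansions and prefix codes\<close>

text \<open>The bit budget has to hold on the whole Besov ball, where \<open>f0\<close> may be
  unbounded, while the risk is taken over functions bounded by M. This forces two moment bounds. The
  random part of a string length is logarithmic, hence at most linear, in the local coefficient, and
  the first absolute moment of the latter is controlled by L2 norms, which are bounded on the Besov
  ball. The mean squared error needs the second moment of an observation times a basis function, and
  there M enters.

  Let X be the value of \<eta> before rounding and capping, l = log_2 n, and R the claimed rate. The
  stochastic term X^2 (B/l) / n is at most R with a power of l to spare. When the cap m is active,
  \<eta> may drop to the order of X l^(-2s/(2+2s)); the squared bias computed from this smaller
  value is R up to a constant, and this is the origin of the factor (log_2 n)^(2s) in M_n.\<close>

lemma sum_binary_digits:
  fixes A :: int
  assumes "A \<ge> 0"
  shows "(\<Sum>r<R. of_bool (odd (A div 2 ^ r)) * 2 ^ r) = A mod 2 ^ R"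
proof (induction R)
  case (Suc R)
  have "A mod 2 ^ Suc R = 2 ^ R * (A div 2 ^ R mod 2) + A mod 2 ^ R"
    by (simp add: mod_mult2_eq' mult.commute[of 2] zmod_zmult2_eq)
  then show ?case using Suc by (simp add: odd_iff_mod_2_eq_one of_bool_def even_iff_mod_2_eq_zero)
qed auto

lemma trans_cutoff_nonneg: "n \<ge> 1 \<Longrightarrow> trans_cutoff n \<ge> 0"
  unfolding trans_cutoff_def by simp

text \<open>The factor 2 is the price of rounding (1/2) log_2 n down to an integer: the cutoff is
  larger than (1/2) log_2 n - 1.\<close>

lemma trans_cutoff_powi_le:
  assumes "n \<ge> 1"
  shows "2 powi (- trans_cutoff n) \<le> 2 / sqrt (real n)"
proof -
  have "sqrt (real n) = (2 powr log 2 (real n)) powr (1/2)"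
    using assms by (simp add: powr_half_sqrt)
  also have "\<dots> = 2 powr ((1/2) * log 2 (real n))" by (simp add: powr_powr)
  also have "\<dots> \<le> 2 powr (of_int (trans_cutoff n) + 1)"
    unfolding trans_cutoff_def by (intro powr_mono) linarith+
  also have "\<dots> = 2 * 2 powi trans_cutoff n"
    by (simp add: powr_add powr_real_of_int')
  finally show ?thesis
    using assms by (simp add: power_int_minus field_simps)
qed

lemma abs_less_trans_range:
  "\<bar>x\<bar> < 2 powi (\<lfloor>log 2 \<bar>x\<bar>\<rfloor> + 1)"
proof (cases "x = 0")
  case False
  have "\<bar>x\<bar> = 2 powr log 2 \<bar>x\<bar>" using False by simp
  also have "\<dots> < 2 powr of_int (\<lfloor>log 2 \<bar>x\<bar>\<rfloor> + 1)"
    by (intro powr_less_mono) linarith+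
  finally show ?thesis by (subst (asm) powr_real_of_int') auto
qed auto

text \<open>The digit of |x| at 2^(r-c) is the r-th digit of the integer A = \<lfloor>|x|
  2^c\<rfloor>. All digits of A lie below position R, so the transmitted ones recover A completely:
  decoding yields x rounded towards 0 to a multiple of 2^(-c).\<close>

lemma trans_value_eq_floor:
  assumes n: "n \<ge> 1"
  shows "trans_value n (trans_approx n x) =
    (if x < 0 then -1 else 1) * (\<lfloor>\<bar>x\<bar> * 2 powi trans_cutoff n\<rfloor> * 2 powi (- trans_cutoff n))"
proof -
  define c where "c = trans_cutoff n"
  define u where "u = \<lfloor>log 2 \<bar>x\<bar>\<rfloor>"
  define R where "R = nat (u + c + 1)"
  define A where "A = \<lfloor>\<bar>x\<bar> * 2 powi c\<rfloor>"
  have A0: "A \<ge> 0" unfolding A_def by simp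
  have dig: "\<lfloor>\<bar>x\<bar> / 2 powi (int r - c)\<rfloor> = A div 2 ^ r" for r
  proof -
    have "\<bar>x\<bar> / 2 powi (int r - c) = (\<bar>x\<bar> * 2 powi c) / real_of_int (2 ^ r)"
      by (simp add: power_int_diff field_simps)
    then show ?thesis unfolding A_def by (metis floor_divide_real_eq_div zero_le_numeral zero_le_power)
  qed
  have AR: "A < 2 ^ R"
  proof -
    have "\<bar>x\<bar> * 2 powi c < 2 powi (u + 1) * 2 powi c"
      using abs_less_trans_range[of x] unfolding u_def by (intro mult_strict_right_mono) auto
    also have "\<dots> = 2 powi (u + c + 1)" by (simp add: power_int_add algebra_simps)
    \<comment> \<open>An inequality because \<open>R\<close> is cut off at 0: if u < -c, no digit is
      sent, and A < 2^0 gives A = 0.\<close>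
    also have "\<dots> \<le> 2 powi (int R)"
      unfolding R_def by (intro power_int_increasing) auto
    finally have "\<bar>x\<bar> * 2 powi c < of_int (2 ^ R)" by simp
    then show ?thesis unfolding A_def by (simp only: floor_less_iff)
  qed
  have "trans_value n (trans_approx n x) = (if x < 0 then -1 else 1) *
      (\<Sum>r<R. of_bool (odd \<lfloor>\<bar>x\<bar> / 2 powi (int r - c)\<rfloor>) * (2::real) powi (int r - c))"
    unfolding trans_value_def trans_approx_def c_def[symmetric] u_def[symmetric]
    by (auto simp: R_def nth_upto algebra_simps intro!: sum.cong)
  also have "(\<Sum>r<R. of_bool (odd \<lfloor>\<bar>x\<bar> / 2 powi (int r - c)\<rfloor>) * (2::real) powi (int r - c)) =
      real_of_int (\<Sum>r<R. of_bool (odd (A div 2 ^ r)) * 2 ^ r) * 2 powi (- c)"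
    unfolding dig of_int_sum sum_distrib_right
    by (intro sum.cong refl) (simp add: power_int_diff power_int_minus field_simps)
  also have "(\<Sum>r<R. of_bool (odd (A div 2 ^ r)) * 2 ^ r) = A"
    using AR A0 unfolding sum_binary_digits[OF A0] by simp
  finally show ?thesis unfolding A_def c_def .
qed

lemma trans_approx_error:
  assumes n: "n \<ge> 1"
  shows "\<bar>trans_value n (trans_approx n x) - x\<bar> \<le> 2 / sqrt (real n)"
proof -
  define c where "c = trans_cutoff n"
  define a where "a = \<bar>x\<bar> * 2 powi c"
  have "x = (if x < 0 then -1 else 1) * (a * 2 powi (- c))"
    unfolding a_def by (simp add: power_int_minus)
  then have "\<bar>trans_value n (trans_approx n x) - x\<bar> =
      \<bar>(if x < 0 then -1 else 1) * ((of_int \<lfloor>a\<rfloor> - a) * 2 powi (- c))\<bar>"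
    unfolding trans_value_eq_floor[OF n] a_def c_def by (simp add: algebra_simps split: if_splits)
  also have "\<dots> = \<bar>of_int \<lfloor>a\<rfloor> - a\<bar> * 2 powi (- c)"
    by (auto simp: abs_mult)
  also have "\<dots> \<le> 1 * 2 powi (- c)"
    by (intro mult_right_mono) (linarith, simp)
  also have "\<dots> \<le> 2 / sqrt (real n)"
    using trans_cutoff_powi_le[OF n] unfolding c_def by simp
  finally show ?thesis .
qed

text \<open>The logarithm is bounded linearly so that the expected length can be controlled by the
  first absolute moment of the transmitted number. The 2 counts the sign bit and the digit at
  2^0.\<close>

lemma length_trans_approx_le:
  fixes x :: real
  assumes n: "n \<ge> 1"
  shows "real (length (trans_approx n x)) \<le> 2 + trans_cutoff n + 2 * \<bar>x\<bar>"
proof -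
  \<comment> \<open>The slope 2 bounds 1 / ln 2. At x = 0 both sides vanish, as
    \<open>log 2 0 = 0\<close>.\<close>
  have "log 2 \<bar>x\<bar> \<le> 2 * \<bar>x\<bar>"
  proof (cases "x = 0")
    case False
    have "log 2 \<bar>x\<bar> = ln \<bar>x\<bar> / ln 2" by (simp add: log_def)
    also have "\<dots> \<le> \<bar>x\<bar> / ln 2"
      using False ln_le_minus_one[of "\<bar>x\<bar>"] by (intro divide_right_mono) auto
    also have "\<dots> \<le> \<bar>x\<bar> / (1/2)"
      using ln2_ge_two_thirds by (intro divide_left_mono) auto
    finally show ?thesis by simp
  qed (simp add: log_def)
  then have "real_of_int \<lfloor>log 2 \<bar>x\<bar>\<rfloor> \<le> 2 * \<bar>x\<bar>" by linarith
  then show ?thesis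
    unfolding trans_approx_def using trans_cutoff_nonneg[OF n] by (auto simp: nat_eq_iff of_nat_nat)
qed

text \<open>The strings \<open>trans_approx n x\<close> do not form a prefix code, so a concatenation of them cannot be
  decoded.  Padding them to at least the common length and announcing the excess length in unary
  makes them decodable; the excess is bounded in expectation, while a budget of $\log_2 n$ bits
  per coefficient leaves about $\frac12 \log_2 n$ bits unused.\<close>

definition pad_bits :: "nat \<Rightarrow> bool list \<Rightarrow> bool list" where
  "pad_bits c bs = bs @ replicate (c - length bs) False"

text \<open>The unary part, closed by the delimiter \<open>False\<close>, tells the reader that
  exactly c plus the excess many bits follow. This is what allows several codes to be
  concatenated.\<close>

definition prefix_code :: "nat \<Rightarrow> bool list \<Rightarrow> bool list" where
  "prefix_code c bs = replicate (length bs - c) True @ False # pad_bits c bs"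

definition prefix_split :: "nat \<Rightarrow> bool list \<Rightarrow> bool list \<times> bool list" where
  "prefix_split c w = (let u = length (takeWhile (\<lambda>b. b) w); v = drop (Suc u) w
     in (take (c + u) v, drop (c + u) v))"

primrec prefix_decode :: "nat \<Rightarrow> nat \<Rightarrow> bool list \<Rightarrow> bool list" where
  "prefix_decode c 0 w = fst (prefix_split c w)"
| "prefix_decode c (Suc r) w = prefix_decode c r (snd (prefix_split c w))"

lemma length_pad_bits: "length (pad_bits c bs) = c + (length bs - c)"
  unfolding pad_bits_def by simp

lemma prefix_split_code: "prefix_split c (prefix_code c bs @ w) = (pad_bits c bs, w)"
proof -
  have "takeWhile (\<lambda>b. b) (prefix_code c bs @ w) = replicate (length bs - c) True"
    unfolding prefix_code_def by (simp add: takeWhile_append)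
  then show ?thesis
    unfolding prefix_split_def by (simp add: prefix_code_def length_pad_bits)
qed

lemma prefix_decode_concat:
  "r < length bss \<Longrightarrow> prefix_decode c r (concat (map (prefix_code c) bss)) = pad_bits c (bss ! r)"
proof (induction bss arbitrary: r)
  case (Cons bs bss)
  then show ?case by (cases r) (auto simp: prefix_split_code)
qed auto

text \<open>Digits are listed with the least significant first, so padding appends zeros above the
  leading digit. Hence the centre may decode the padded string without ever recovering the original
  one.\<close>

lemma trans_value_pad_bits: "trans_value n (pad_bits c bs) = trans_value n bs"
proof (cases bs)
  case Nil
  then show ?thesis
    by (cases c) (auto simp: pad_bits_def trans_value_def intro!: sum.neutral)
next
  case (Cons b ds)
  define e where "e = c - length bs"
  have "(\<Sum>r<length ds + e. of_bool ((ds @ replicate e False) ! r) * (2::real) powi (int r - trans_cutoff n))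
      = (\<Sum>r<length ds. of_bool ((ds @ replicate e False) ! r) * 2 powi (int r - trans_cutoff n))"
    by (rule sum.mono_neutral_right) (auto simp: nth_append)
  also have "\<dots> = (\<Sum>r<length ds. of_bool (ds ! r) * 2 powi (int r - trans_cutoff n))"
    by (rule sum.cong) (auto simp: nth_append)
  finally show ?thesis
    using Cons by (simp add: pad_bits_def trans_value_def e_def)
qed

text \<open>The excess, at most 2 + 2|x|, is paid twice, in unary and inside the string; the
  delimiter makes the constant 5.\<close>

lemma length_prefix_code_trans_approx_le:
  assumes n: "n \<ge> 1"
  shows "real (length (prefix_code (nat (trans_cutoff n)) (trans_approx n x)))
    \<le> 5 + (1/2) * log 2 (real n) + 4 * \<bar>x\<bar>"
proof -
  have c: "of_int (trans_cutoff n) \<le> (1/2) * log 2 (real n)" unfolding trans_cutoff_def by linarith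
  have "real (length (trans_approx n x) - nat (trans_cutoff n)) \<le> 2 + 2 * \<bar>x\<bar>"
    using length_trans_approx_le[OF n, of x] trans_cutoff_nonneg[OF n] by linarith
  then show ?thesis
    using c trans_cutoff_nonneg[OF n] unfolding prefix_code_def by (simp add: length_pad_bits)
qed

section \<open>Measurability of the transmitted strings\<close>

lemma measurable_Cons_count_space:
  fixes f :: "'a \<Rightarrow> 'b::countable" and g :: "'a \<Rightarrow> 'b list"
  assumes "f \<in> M \<rightarrow>\<^sub>M count_space UNIV" and "g \<in> M \<rightarrow>\<^sub>M count_space UNIV"
  shows "(\<lambda>x. f x # g x) \<in> M \<rightarrow>\<^sub>M count_space UNIV"
proof (rule measurable_compose_countable[OF _ assms(1)])
  show "(\<lambda>x. y # g x) \<in> M \<rightarrow>\<^sub>M count_space UNIV" for y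
    using assms(2) by (rule measurable_compose) simp
qed

lemma measurable_map_count_space:
  fixes P :: "'k \<Rightarrow> 'a \<Rightarrow> 'b::countable"
  assumes "\<And>k. k \<in> set ks \<Longrightarrow> P k \<in> M \<rightarrow>\<^sub>M count_space UNIV"
  shows "(\<lambda>x. map (\<lambda>k. P k x) ks) \<in> M \<rightarrow>\<^sub>M count_space UNIV"
  using assms by (induction ks) (auto intro!: measurable_Cons_count_space)

lemma measurable_trans_approx: "trans_approx n \<in> borel \<rightarrow>\<^sub>M count_space UNIV"
proof -
  have 1: "(\<lambda>x::real. \<lfloor>log 2 \<bar>x\<bar>\<rfloor>) \<in> borel \<rightarrow>\<^sub>M count_space UNIV" by measurable
  have 2: "(\<lambda>x::real. map (\<lambda>k. odd \<lfloor>\<bar>x\<bar> / 2 powi k\<rfloor>) ks) \<in> borel \<rightarrow>\<^sub>M count_space UNIV" for ks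
    by (rule measurable_map_count_space) measurable
  \<comment> \<open>The list of exponents depends on x, but only through an integer; splitting over
    its countably many values leaves a fixed list.\<close>
  have "(\<lambda>x::real. map (\<lambda>k. odd \<lfloor>\<bar>x\<bar> / 2 powi k\<rfloor>) [- trans_cutoff n..\<lfloor>log 2 \<bar>x\<bar>\<rfloor>])
      \<in> borel \<rightarrow>\<^sub>M count_space UNIV"
    by (rule measurable_compose_countable[OF 2 1])
  then show ?thesis
    unfolding trans_approx_def[abs_def] by (intro measurable_Cons_count_space) auto
qed

section \<open>Expansions in $L_2[0,1]$\<close>

lemma L2_unit_mult_integrable:
  assumes "f \<in> L2_unit" and "g \<in> L2_unit"
  shows "set_integrable lborel {0..1} (\<lambda>x. f x * g x)"
proof -
  have [measurable]: "f \<in> borel_measurable borel" "g \<in> borel_measurable borel"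
    using assms by (auto simp: L2_unit_def)
  have "set_integrable lborel {0..1} (\<lambda>x. (f x)\<^sup>2 + (g x)\<^sup>2)"
    using assms by (intro set_integral_add) (auto simp: L2_unit_def)
  then show ?thesis
    unfolding set_integrable_def
  proof (rule Bochner_Integration.integrable_bound)
    have "\<bar>a * b\<bar> \<le> a\<^sup>2 + b\<^sup>2" for a b :: real
      using sum_squares_bound[of "\<bar>a\<bar>" "\<bar>b\<bar>"] mult_nonneg_nonneg[of "\<bar>a\<bar>" "\<bar>b\<bar>"]
      unfolding abs_mult power2_abs by linarith
    then show "AE x in lborel. norm (indicat_real {0..1} x *\<^sub>R (f x * g x))
        \<le> norm (indicat_real {0..1} x *\<^sub>R ((f x)\<^sup>2 + (g x)\<^sup>2))"
      by (auto simp: indicator_def)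
  qed measurable
qed

lemma L2_unit_scale: "f \<in> L2_unit \<Longrightarrow> (\<lambda>x. a * f x) \<in> L2_unit"
  unfolding L2_unit_def by (auto simp: power_mult_distrib)

lemma L2_unit_add:
  assumes "f \<in> L2_unit" and "g \<in> L2_unit"
  shows "(\<lambda>x. f x + g x) \<in> L2_unit"
proof -
  have "set_integrable lborel {0..1} (\<lambda>x. (f x)\<^sup>2 + 2 * (f x * g x) + (g x)\<^sup>2)"
    using assms L2_unit_mult_integrable[OF assms]
    by (intro set_integral_add set_integrable_mult_right) (auto simp: L2_unit_def)
  then show ?thesis
    using assms unfolding L2_unit_def by (auto simp: power2_sum algebra_simps)
qed

lemma L2_unit_sum:
  assumes "\<And>i. i \<in> A \<Longrightarrow> f i \<in> L2_unit"
  shows "(\<lambda>x. \<Sum>i\<in>A. f i x) \<in> L2_unit"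
  using assms
proof (induction A rule: infinite_finite_induct)
  case (insert i A)
  then show ?case using L2_unit_add[of "f i" "\<lambda>x. \<Sum>i\<in>A. f i x"] by simp
qed (auto simp: L2_unit_def set_integrable_def)

lemma inner_unit_commute: "inner_unit f g = inner_unit g f"
  unfolding inner_unit_def by (simp add: mult.commute)

lemma inner_unit_scale: "inner_unit (\<lambda>x. a * f x) g = a * inner_unit f g"
  unfolding inner_unit_def by (simp add: mult.assoc)

lemma inner_unit_add:
  assumes "f \<in> L2_unit" "g \<in> L2_unit" "h \<in> L2_unit"
  shows "inner_unit (\<lambda>x. f x + g x) h = inner_unit f h + inner_unit g h"
  unfolding inner_unit_def using L2_unit_mult_integrable assms
  by (simp add: distrib_right set_integral_add)

lemma inner_unit_sum:
  assumes "\<And>i. i \<in> A \<Longrightarrow> f i \<in> L2_unit" and "h \<in> L2_unit"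
  shows "inner_unit (\<lambda>x. \<Sum>i\<in>A. f i x) h = (\<Sum>i\<in>A. inner_unit (f i) h)"
  using assms(1)
proof (induction A rule: infinite_finite_induct)
  case (insert i A)
  then show ?case
    using inner_unit_add[of "f i" "\<lambda>x. \<Sum>i\<in>A. f i x" h] assms(2) L2_unit_sum[of A f] by simp
qed (auto simp: inner_unit_def)

lemma inner_unit_square_diff:
  assumes f: "f \<in> L2_unit" and g: "g \<in> L2_unit"
  shows "(LINT x:{0..1}|lborel. (f x - g x)\<^sup>2) = inner_unit f f - 2 * inner_unit f g + inner_unit g g"
proof -
  define d where "d = (\<lambda>x. f x - g x)"
  have d: "d \<in> L2_unit"
    unfolding d_def using L2_unit_add[OF f L2_unit_scale[OF g, of "-1"]] by simp
  have diff: "inner_unit d h = inner_unit f h - inner_unit g h" if "h \<in> L2_unit" for h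
    unfolding d_def inner_unit_def left_diff_distrib
    by (intro set_integral_diff L2_unit_mult_integrable f g that)
  have "(LINT x:{0..1}|lborel. (f x - g x)\<^sup>2) = inner_unit d d"
    unfolding inner_unit_def d_def by (simp add: power2_eq_square)
  then show ?thesis
    using diff[OF d] diff[OF f] diff[OF g] inner_unit_commute[of f d] inner_unit_commute[of g d]
      inner_unit_commute[of g f] by linarith
qed

text \<open>Pythagoras: the first sum is the error inside the span, the bracket is the squared
  distance of f from the span. With a equal to the true coefficients it gives Parseval's identity,
  with a equal to the estimated ones the decomposition of the risk.\<close>

lemma sum_orthonormal_square_diff:
  fixes \<psi> :: "'i \<Rightarrow> real \<Rightarrow> real"
  assumes fin: "finite A" and L2: "\<And>i. i \<in> A \<Longrightarrow> \<psi> i \<in> L2_unit"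
    and on: "\<And>i i'. i \<in> A \<Longrightarrow> i' \<in> A \<Longrightarrow> inner_unit (\<psi> i) (\<psi> i') = (if i = i' then 1 else 0)"
    and f: "f \<in> L2_unit"
  shows "(LINT x:{0..1}|lborel. ((\<Sum>i\<in>A. a i * \<psi> i x) - f x)\<^sup>2) =
    (\<Sum>i\<in>A. (a i - inner_unit f (\<psi> i))\<^sup>2) + (inner_unit f f - (\<Sum>i\<in>A. (inner_unit f (\<psi> i))\<^sup>2))"
proof -
  define S where "S = (\<lambda>x. \<Sum>i\<in>A. a i * \<psi> i x)"
  have S: "S \<in> L2_unit" unfolding S_def by (intro L2_unit_sum L2_unit_scale L2)
  have in1: "inner_unit S h = (\<Sum>i\<in>A. a i * inner_unit (\<psi> i) h)" if "h \<in> L2_unit" for h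
    unfolding S_def using inner_unit_sum[of A "\<lambda>i x. a i * \<psi> i x" h] that L2
    by (simp add: L2_unit_scale inner_unit_scale)
  have in2: "inner_unit (\<psi> i) S = a i" if "i \<in> A" for i
    using in1[OF L2[OF that]] that fin
    unfolding inner_unit_commute[of "\<psi> i" S]
    by (simp add: on if_distrib[of "\<lambda>x. a _ * x"] cong: if_cong)
  have "(LINT x:{0..1}|lborel. (S x - f x)\<^sup>2) = inner_unit S S - 2 * inner_unit S f + inner_unit f f"
    by (rule inner_unit_square_diff[OF S f])
  also have "inner_unit S S = (\<Sum>i\<in>A. (a i)\<^sup>2)"
    unfolding in1[OF S] by (simp add: in2 power2_eq_square)
  also have "inner_unit S f = (\<Sum>i\<in>A. a i * inner_unit f (\<psi> i))"
    unfolding in1[OF f] inner_unit_commute[of f] ..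
  finally show ?thesis
    unfolding S_def by (simp add: power2_diff sum.distrib sum_subtractf sum_distrib_left mult.assoc)
qed

lemma orthonormal_basis_unitD:
  assumes "orthonormal_basis_unit \<psi>"
  shows "k < 2^j \<Longrightarrow> \<psi> j k \<in> L2_unit"
    and "k < 2^j \<Longrightarrow> k' < 2^j' \<Longrightarrow> inner_unit (\<psi> j k) (\<psi> j' k') = (if j = j' \<and> k = k' then 1 else 0)"
  using assms unfolding orthonormal_basis_unit_def by auto

text \<open>For the true coefficients only the bracket of the Pythagorean decomposition survives,
  and completeness of the basis sends it to 0.\<close>

lemma parseval_unit:
  assumes \<psi>: "orthonormal_basis_unit \<psi>" and f: "f \<in> L2_unit"
  shows "(\<lambda>J. \<Sum>j<J. \<Sum>k<2^j. (inner_unit f (\<psi> j k))\<^sup>2) \<longlonglongrightarrow> inner_unit f f"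
proof -
  let ?c = "\<lambda>p. inner_unit f (case_prod \<psi> p)"
  let ?A = "\<lambda>J::nat. SIGMA j:{..<J}. {..<2^j::nat}"
  have "(LINT x:{0..1}|lborel. (f x - (\<Sum>j<J. \<Sum>k<2^j. inner_unit f (\<psi> j k) * \<psi> j k x))\<^sup>2)
      = inner_unit f f - (\<Sum>j<J. \<Sum>k<2^j. (inner_unit f (\<psi> j k))\<^sup>2)" for J
  proof -
    have "(LINT x:{0..1}|lborel. ((\<Sum>p\<in>?A J. ?c p * case_prod \<psi> p x) - f x)\<^sup>2)
        = (\<Sum>p\<in>?A J. (?c p - ?c p)\<^sup>2) + (inner_unit f f - (\<Sum>p\<in>?A J. (?c p)\<^sup>2))"
      by (rule sum_orthonormal_square_diff) (auto simp: orthonormal_basis_unitD[OF \<psi>] f split: if_splits)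
    then show ?thesis
      by (simp add: sum.Sigma case_prod_unfold power2_commute[of "f _"])
  qed
  moreover have "(\<lambda>J. LINT x:{0..1}|lborel.
      (f x - (\<Sum>j<J. \<Sum>k<2^j. inner_unit f (\<psi> j k) * \<psi> j k x))\<^sup>2) \<longlonglongrightarrow> 0"
    using \<psi> f unfolding orthonormal_basis_unit_def by blast
  ultimately have "(\<lambda>J. inner_unit f f - (\<Sum>j<J. \<Sum>k<2^j. (inner_unit f (\<psi> j k))\<^sup>2)) \<longlonglongrightarrow> 0"
    by simp
  then have "(\<lambda>J. inner_unit f f - (inner_unit f f - (\<Sum>j<J. \<Sum>k<2^j. (inner_unit f (\<psi> j k))\<^sup>2)))
      \<longlonglongrightarrow> inner_unit f f - 0"
    by (intro tendsto_intros)
  then show ?thesis by simp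
qed

section \<open>Decay of coefficients in Besov balls\<close>

lemma besov_ball_level:
  assumes f: "f \<in> besov_ball \<psi> s L"
  shows "(\<Sum>k<2^j. (inner_unit f (\<psi> j k))\<^sup>2) \<le> L\<^sup>2 * (2 powr (- (2 * s))) ^ j"
proof -
  have "ennreal (2 powr (2 * real j * s) * (\<Sum>k<2^j. (inner_unit f (\<psi> j k))\<^sup>2)) \<le> besov_norm_sq \<psi> s f"
    unfolding besov_norm_sq_def by (rule SUP_upper) auto
  also have "\<dots> \<le> ennreal (L\<^sup>2)" using f unfolding besov_ball_def by auto
  finally have *: "2 powr (2 * real j * s) * (\<Sum>k<2^j. (inner_unit f (\<psi> j k))\<^sup>2) \<le> L\<^sup>2"
    by (subst (asm) ennreal_le_iff) auto
  have Q: "(2 powr (- (2 * s))) ^ j = (2::real) powr (- (2 * real j * s))"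
    by (simp add: powr_realpow[symmetric] powr_powr mult_ac)
  have "(\<Sum>k<2^j. (inner_unit f (\<psi> j k))\<^sup>2) =
      2 powr (- (2 * real j * s)) * (2 powr (2 * real j * s) * (\<Sum>k<2^j. (inner_unit f (\<psi> j k))\<^sup>2))"
    by (simp add: mult.assoc[symmetric] powr_add[symmetric])
  also have "\<dots> \<le> 2 powr (- (2 * real j * s)) * L\<^sup>2"
    by (intro mult_left_mono *) auto
  finally show ?thesis unfolding Q by (simp add: mult.commute)
qed

text \<open>The set A need not end at a full level: coefficients in A beyond level J only reduce the
  left side, and the levels from J on are summed as a geometric series. The case of empty A and J =
  0 bounds the squared L2 norm on the ball.\<close>

lemma besov_ball_tail:
  assumes \<psi>: "orthonormal_basis_unit \<psi>" and s: "s > 0" and f: "f \<in> besov_ball \<psi> s L"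
    and A: "finite A" "\<And>j k. j < J \<Longrightarrow> k < 2^j \<Longrightarrow> (j, k) \<in> A"
  shows "inner_unit f f - (\<Sum>(j, k)\<in>A. (inner_unit f (\<psi> j k))\<^sup>2)
    \<le> L\<^sup>2 * (2 powr (- (2 * s))) ^ J / (1 - 2 powr (- (2 * s)))"
proof -
  define q where "q = (2::real) powr (- (2 * s))"
  have q: "0 < q" "q < 1" unfolding q_def using s by (auto simp: powr_less_one)
  define C where "C j = (\<Sum>k<2^j. (inner_unit f (\<psi> j k))\<^sup>2)" for j
  have "(\<Sum>j<J'. C j) \<le> (\<Sum>(j, k)\<in>A. (inner_unit f (\<psi> j k))\<^sup>2) + L\<^sup>2 * q ^ J / (1 - q)" for J'
  proof -
    \<comment> \<open>Passing to J + J' levels avoids distinguishing whether J' exceeds J.\<close>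
    have "(\<Sum>j<J'. C j) \<le> (\<Sum>j<J + J'. C j)"
      unfolding C_def by (intro sum_mono2) (auto intro: sum_nonneg)
    also have "\<dots> = (\<Sum>j<J. C j) + (\<Sum>i<J'. C (J + i))"
      by (induction J') auto
    also have "(\<Sum>j<J. C j) = (\<Sum>(j, k)\<in>(SIGMA j:{..<J}. {..<2^j}). (inner_unit f (\<psi> j k))\<^sup>2)"
      unfolding C_def by (simp add: sum.Sigma)
    also have "\<dots> \<le> (\<Sum>(j, k)\<in>A. (inner_unit f (\<psi> j k))\<^sup>2)"
      using A by (intro sum_mono2) auto
    also have "(\<Sum>i<J'. C (J + i)) \<le> (\<Sum>i<J'. L\<^sup>2 * q ^ (J + i))"
      unfolding C_def q_def by (intro sum_mono besov_ball_level[OF f])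
    also have "\<dots> = L\<^sup>2 * q ^ J * (\<Sum>i<J'. q ^ i)"
      by (simp add: sum_distrib_left power_add mult.assoc)
    also have "\<dots> \<le> L\<^sup>2 * q ^ J * (1 / (1 - q))"
      using q by (intro mult_left_mono) (auto simp: sum_gp_strict divide_right_mono)
    finally show ?thesis by simp
  qed
  moreover have "f \<in> L2_unit" using f unfolding besov_ball_def by auto
  ultimately have "inner_unit f f \<le> (\<Sum>(j, k)\<in>A. (inner_unit f (\<psi> j k))\<^sup>2) + L\<^sup>2 * q ^ J / (1 - q)"
    using LIMSEQ_le_const2[OF parseval_unit[OF \<psi>]] unfolding C_def by blast
  then show ?thesis unfolding q_def by simp
qed

section \<open>Moments of the observations\<close>

lemma ennreal_affine:
  "x \<ge> 0 \<Longrightarrow> y \<ge> 0 \<Longrightarrow> a \<ge> 0 \<Longrightarrow> ennreal x + ennreal y * ennreal a = ennreal (x + y * a)"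
  by (simp add: ennreal_mult)

text \<open>Independence kills the mixed terms of the squared sum. The lemma is applied twice, to
  the observations of one machine and then, with their centred sum as the new h, to the machines; so
  it also returns integrability and mean zero, and it allows a subset J of the coordinates.\<close>

lemma iid_sum_moments:
  fixes h :: "'a \<Rightarrow> real"
  assumes M: "prob_space M" and I: "finite I" "J \<subseteq> I"
    and h: "integrable M h" "integrable M (\<lambda>x. (h x)\<^sup>2)" "(\<integral>x. h x \<partial>M) = 0"
  defines "P \<equiv> PiM I (\<lambda>_. M)"
  shows "integrable P (\<lambda>z. \<Sum>i\<in>J. h (z i))"
    and "integrable P (\<lambda>z. (\<Sum>i\<in>J. h (z i))\<^sup>2)"
    and "(\<integral>z. (\<Sum>i\<in>J. h (z i)) \<partial>P) = 0"
    and "(\<integral>z. (\<Sum>i\<in>J. h (z i))\<^sup>2 \<partial>P) = real (card J) * (\<integral>x. (h x)\<^sup>2 \<partial>M)"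
proof -
  interpret M: prob_space M by fact
  interpret product_prob_space "\<lambda>_. M" I by unfold_locales
  have [measurable]: "h \<in> borel_measurable M" using h by auto
  have comp: "integrable P (\<lambda>z. g (z i)) \<and> (\<integral>z. g (z i) \<partial>P) = (\<integral>x. g x \<partial>M)"
    if "i \<in> J" "integrable M g" for i and g :: "'a \<Rightarrow> real"
  proof -
    have i: "i \<in> I" using that I by auto
    have d: "distr P M (\<lambda>z. z i) = M" unfolding P_def using i by (rule PiM_component)
    have m: "(\<lambda>z. z i) \<in> P \<rightarrow>\<^sub>M M" unfolding P_def using i by measurable
    have "integrable (distr P M (\<lambda>z. z i)) g" unfolding d using that by simp
    then have "integrable P (\<lambda>z. g (z i))" by (rule integrable_distr[OF m])
    moreover have "integral\<^sup>L (distr P M (\<lambda>z. z i)) g = (\<integral>z. g (z i) \<partial>P)"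
      using that m by (intro integral_distr) auto
    ultimately show ?thesis using d by simp
  qed
  have cross: "integrable P (\<lambda>z. h (z i) * h (z k)) \<and>
      (\<integral>z. h (z i) * h (z k) \<partial>P) = (if i = k then \<integral>x. (h x)\<^sup>2 \<partial>M else 0)"
    if ik: "i \<in> J" "k \<in> J" for i k
  proof (cases "i = k")
    case True
    then show ?thesis using comp[OF ik(1) h(2)] by (simp add: power2_eq_square)
  next
    case False
    \<comment> \<open>Filling the other coordinates with the constant 1 turns the mixed term into a
      product over all of I, whose integral factorises; the factor at i is the mean of h, which is
      0.\<close>
    define F where "F = (\<lambda>l x. if l \<in> {i, k} then h x else 1)"
    have F: "integrable M (F l)" for l using h by (cases "l \<in> {i, k}") (auto simp: F_def)
    have prod: "(\<Prod>l\<in>I. F l (z l)) = h (z i) * h (z k)" for z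
    proof -
      have "(\<Prod>l\<in>I. F l (z l)) = (\<Prod>l\<in>{i, k}. F l (z l))"
        using I ik by (intro prod.mono_neutral_right) (auto simp: F_def)
      then show ?thesis using False by (simp add: F_def)
    qed
    have "(\<Prod>l\<in>I. \<integral>x. F l x \<partial>M) = 0"
      using I ik h(3) by (intro prod_zero) (auto simp: F_def intro!: bexI[of _ i])
    then show ?thesis
      using product_integral_prod[OF I(1), of F] product_integrable_prod[OF I(1), of F] F False
      unfolding prod P_def by simp
  qed
  show "integrable P (\<lambda>z. \<Sum>i\<in>J. h (z i))" "(\<integral>z. (\<Sum>i\<in>J. h (z i)) \<partial>P) = 0"
    using comp[OF _ h(1)] h(3) by auto
  have sq: "(\<lambda>z. (\<Sum>i\<in>J. h (z i))\<^sup>2) = (\<lambda>z. \<Sum>i\<in>J. \<Sum>k\<in>J. h (z i) * h (z k))"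
    by (simp add: power2_eq_square sum_product)
  show "integrable P (\<lambda>z. (\<Sum>i\<in>J. h (z i))\<^sup>2)"
    unfolding sq using cross by auto
  have "finite J" using I finite_subset by auto
  moreover have "(\<integral>z. (\<Sum>i\<in>J. h (z i))\<^sup>2 \<partial>P) = (\<Sum>i\<in>J. \<Sum>k\<in>J. if i = k then \<integral>x. (h x)\<^sup>2 \<partial>M else 0)"
    unfolding sq using cross by simp
  ultimately show "(\<integral>z. (\<Sum>i\<in>J. h (z i))\<^sup>2 \<partial>P) = real (card J) * (\<integral>x. (h x)\<^sup>2 \<partial>M)"
    by simp
qed

section \<open>The law of one observation and its moments\<close>

lemma uniform_unit_eq_density:
  "uniform_measure lborel {0<..<1::real} = density lborel (\<lambda>x. ennreal (indicat_real {0..1} x))"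
  unfolding uniform_measure_def
proof (rule density_cong)
  \<comment> \<open>The design law lives on the open interval, inner products are taken over the
    closed one; the endpoints are null sets.\<close>
  have "AE x in lborel. x \<noteq> (0::real)" "AE x in lborel. x \<noteq> (1::real)"
    by (rule AE_lborel_singleton)+
  then show "AE x in lborel. indicator {0<..<1::real} x / emeasure lborel {0<..<1::real} = ennreal (indicat_real {0..1} x)"
    by eventually_elim (auto simp: indicator_def)
qed auto

abbreviation gauss :: "real measure" where
  "gauss \<equiv> density lborel std_normal_density"

lemma prob_space_unit: "prob_space (uniform_measure lborel {0<..<1::real})"
  by (rule prob_space_uniform_measure) auto

lemma prob_space_gauss: "prob_space gauss"
  by (rule prob_space_normal_density) simp

lemma gauss_moments:
  "integrable gauss (\<lambda>x. x)" "integrable gauss (\<lambda>x. x\<^sup>2)"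
  "(\<integral>x. x \<partial>gauss) = 0" "(\<integral>x. x\<^sup>2 \<partial>gauss) = 1"
  using integrable_std_normal_moment[of 1] integrable_std_normal_moment[of 2]
    integral_std_normal_moment_odd[of 0] integral_std_normal_moment_even[of 1]
  by (auto simp: integrable_density integral_density)

lemma nn_integral_gauss_quadratic:
  assumes "a \<ge> 0" "b \<ge> 0"
  shows "(\<integral>\<^sup>+e. ennreal (a + b * e\<^sup>2) \<partial>gauss) = ennreal (a + b)"
proof -
  interpret prob_space gauss by (rule prob_space_gauss)
  have "(\<integral>\<^sup>+e. ennreal (a + b * e\<^sup>2) \<partial>gauss) = ennreal (\<integral>e. a + b * e\<^sup>2 \<partial>gauss)"
    using assms gauss_moments by (intro nn_integral_eq_integral) auto
  also have "(\<integral>e. a + b * e\<^sup>2 \<partial>gauss) = a + b"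
    using gauss_moments prob_space by simp
  finally show ?thesis .
qed

lemma sets_obs_law [measurable_cong]: "sets (obs_law \<sigma> f0) = sets (borel \<Otimes>\<^sub>M borel)"
  unfolding obs_law_def by simp

lemma measurable_obs_map:
  assumes [measurable]: "f0 \<in> borel_measurable borel"
  shows "(\<lambda>(t, e). (t, f0 t + \<sigma> * e)) \<in> uniform_measure lborel {0<..<1::real} \<Otimes>\<^sub>M gauss \<rightarrow>\<^sub>M borel \<Otimes>\<^sub>M borel"
  by measurable

lemma prob_space_obs_law:
  assumes [measurable]: "f0 \<in> borel_measurable borel"
  shows "prob_space (obs_law \<sigma> f0)"
proof -
  interpret U: prob_space "uniform_measure lborel {0<..<1::real}" by (rule prob_space_unit)
  interpret G: prob_space gauss by (rule prob_space_gauss)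
  interpret pair_prob_space "uniform_measure lborel {0<..<1::real}" gauss ..
  show ?thesis
    unfolding obs_law_def by (rule prob_space_distr[OF measurable_obs_map[OF assms]])
qed

lemma nn_integral_obs_law:
  assumes [measurable]: "f0 \<in> borel_measurable borel" "g \<in> borel_measurable (borel \<Otimes>\<^sub>M borel)"
  shows "(\<integral>\<^sup>+y. g y \<partial>obs_law \<sigma> f0) = (\<integral>\<^sup>+t\<in>{0..1}. (\<integral>\<^sup>+e. g (t, f0 t + \<sigma> * e) \<partial>gauss) \<partial>lborel)"
proof -
  interpret G: prob_space gauss by (rule prob_space_gauss)
  have "(\<integral>\<^sup>+y. g y \<partial>obs_law \<sigma> f0) =
      (\<integral>\<^sup>+p. g (fst p, f0 (fst p) + \<sigma> * snd p) \<partial>(uniform_measure lborel {0<..<1::real} \<Otimes>\<^sub>M gauss))"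
    unfolding obs_law_def by (subst nn_integral_distr) (auto simp: case_prod_unfold)
  also have "\<dots> = (\<integral>\<^sup>+t. (\<integral>\<^sup>+e. g (t, f0 t + \<sigma> * e) \<partial>gauss) \<partial>uniform_measure lborel {0<..<1::real})"
    by (subst G.nn_integral_fst[symmetric]) auto
  also have "\<dots> = (\<integral>\<^sup>+t\<in>{0..1}. (\<integral>\<^sup>+e. g (t, f0 t + \<sigma> * e) \<partial>gauss) \<partial>lborel)"
    unfolding uniform_unit_eq_density
    by (subst nn_integral_density) (auto intro!: nn_integral_cong simp: indicator_def)
  finally show ?thesis .
qed

lemma nn_integral_unit_L2:
  assumes "f \<in> L2_unit"
  shows "(\<integral>\<^sup>+t\<in>{0..1}. ennreal ((f t)\<^sup>2) \<partial>lborel) = ennreal (inner_unit f f)"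
proof -
  have "(\<integral>\<^sup>+t\<in>{0..1}. ennreal ((f t)\<^sup>2) \<partial>lborel) = (\<integral>\<^sup>+t. ennreal (indicat_real {0..1} t *\<^sub>R (f t)\<^sup>2) \<partial>lborel)"
    by (intro nn_integral_cong) (auto simp: indicator_def)
  also have "\<dots> = ennreal (LINT t:{0..1}|lborel. (f t)\<^sup>2)"
    using assms unfolding set_lebesgue_integral_def
    by (intro nn_integral_eq_integral) (auto simp: L2_unit_def set_integrable_def)
  finally show ?thesis unfolding inner_unit_def by (simp add: power2_eq_square)
qed

lemma ennreal_combination:
  assumes "a \<ge> 0" "b \<ge> 0" "x \<ge> 0" "y \<ge> 0" "c \<ge> 0"
  shows "ennreal x * ennreal a + (ennreal y * ennreal b + ennreal c) = ennreal (x * a + (y * b + c))"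
  using assms by (simp add: ennreal_mult)

text \<open>The inequality |xy| \<le> (x^2 + y^2) / 2, applied to f0 g and to the noise times g,
  leaves only L2 norms. This form serves the bit budget, which must hold for unbounded f0 as
  well.\<close>

lemma obs_law_abs_moment:
  assumes f0: "f0 \<in> L2_unit" and g: "g \<in> L2_unit" and \<sigma>: "\<sigma> \<ge> 0"
  shows "(\<integral>\<^sup>+y. ennreal \<bar>snd y * g (fst y)\<bar> \<partial>obs_law \<sigma> f0)
    \<le> ennreal ((inner_unit f0 f0 + inner_unit g g) / 2 + \<sigma> * (1 + inner_unit g g) / 2)"
proof -
  have [measurable]: "f0 \<in> borel_measurable borel" "g \<in> borel_measurable borel"
    using f0 g by (auto simp: L2_unit_def)
  have nn: "inner_unit f f \<ge> 0" if "f \<in> L2_unit" for f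
    unfolding inner_unit_def set_lebesgue_integral_def by (rule Bochner_Integration.integral_nonneg) auto
  have "(\<integral>\<^sup>+y. ennreal \<bar>snd y * g (fst y)\<bar> \<partial>obs_law \<sigma> f0)
      = (\<integral>\<^sup>+t\<in>{0..1}. (\<integral>\<^sup>+e. ennreal \<bar>(f0 t + \<sigma> * e) * g t\<bar> \<partial>gauss) \<partial>lborel)"
    by (subst nn_integral_obs_law) auto
  also have "\<dots> \<le> (\<integral>\<^sup>+t\<in>{0..1}. ennreal (((f0 t)\<^sup>2 + (g t)\<^sup>2) / 2 + \<sigma> * (g t)\<^sup>2 / 2 + \<sigma> / 2) \<partial>lborel)"
  proof (intro nn_integral_mono mult_right_mono)
    fix t :: real
    have "\<bar>(f0 t + \<sigma> * e) * g t\<bar> \<le> ((f0 t)\<^sup>2 + (g t)\<^sup>2) / 2 + \<sigma> * (g t)\<^sup>2 / 2 + \<sigma> / 2 * e\<^sup>2" for e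
    proof -
      have am: "\<bar>a * b\<bar> \<le> (a\<^sup>2 + b\<^sup>2) / 2" for a b :: real
        using sum_squares_bound[of "\<bar>a\<bar>" "\<bar>b\<bar>"] by (simp add: abs_mult)
      have "\<bar>(f0 t + \<sigma> * e) * g t\<bar> \<le> \<bar>f0 t * g t\<bar> + \<sigma> * \<bar>e * g t\<bar>"
        using abs_triangle_ineq[of "f0 t * g t" "\<sigma> * e * g t"] \<sigma> by (simp add: distrib_right abs_mult mult.assoc)
      also have "\<dots> \<le> ((f0 t)\<^sup>2 + (g t)\<^sup>2) / 2 + \<sigma> * ((e\<^sup>2 + (g t)\<^sup>2) / 2)"
        by (intro add_mono mult_left_mono am \<sigma>)
      finally show ?thesis by (simp add: field_simps)
    qed
    then have "(\<integral>\<^sup>+e. ennreal \<bar>(f0 t + \<sigma> * e) * g t\<bar> \<partial>gauss)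
        \<le> (\<integral>\<^sup>+e. ennreal (((f0 t)\<^sup>2 + (g t)\<^sup>2) / 2 + \<sigma> * (g t)\<^sup>2 / 2 + \<sigma> / 2 * e\<^sup>2) \<partial>gauss)"
      by (intro nn_integral_mono ennreal_leI)
    also have "\<dots> = ennreal (((f0 t)\<^sup>2 + (g t)\<^sup>2) / 2 + \<sigma> * (g t)\<^sup>2 / 2 + \<sigma> / 2)"
      using \<sigma> by (intro nn_integral_gauss_quadratic) auto
    finally show "(\<integral>\<^sup>+e. ennreal \<bar>(f0 t + \<sigma> * e) * g t\<bar> \<partial>gauss)
        \<le> ennreal (((f0 t)\<^sup>2 + (g t)\<^sup>2) / 2 + \<sigma> * (g t)\<^sup>2 / 2 + \<sigma> / 2)" .
  qed auto
  also have "\<dots> = (\<integral>\<^sup>+t. ennreal (1/2) * (ennreal ((f0 t)\<^sup>2) * indicator {0..1} t) +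
        (ennreal ((1 + \<sigma>) / 2) * (ennreal ((g t)\<^sup>2) * indicator {0..1} t) +
         ennreal (\<sigma> / 2) * indicator {0..1} t) \<partial>lborel)"
  proof (intro nn_integral_cong)
    fix t :: real
    show "ennreal (((f0 t)\<^sup>2 + (g t)\<^sup>2) / 2 + \<sigma> * (g t)\<^sup>2 / 2 + \<sigma> / 2) * indicator {0..1} t =
        ennreal (1/2) * (ennreal ((f0 t)\<^sup>2) * indicator {0..1} t) +
        (ennreal ((1 + \<sigma>) / 2) * (ennreal ((g t)\<^sup>2) * indicator {0..1} t) +
         ennreal (\<sigma> / 2) * indicator {0..1} t)"
      using ennreal_combination[of "(f0 t)\<^sup>2" "(g t)\<^sup>2" "1/2" "(1 + \<sigma>) / 2" "\<sigma> / 2"] \<sigma>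
      by (cases "t \<in> {0..1}") (auto simp: field_simps)
  qed
  also have "\<dots> = ennreal (1/2) * ennreal (inner_unit f0 f0) +
      (ennreal ((1 + \<sigma>) / 2) * ennreal (inner_unit g g) + ennreal (\<sigma> / 2))"
    by (simp add: nn_integral_add nn_integral_cmult nn_integral_unit_L2 f0 g)
  also have "\<dots> = ennreal ((inner_unit f0 f0 + inner_unit g g) / 2 + \<sigma> * (1 + inner_unit g g) / 2)"
    using ennreal_combination[of "inner_unit f0 f0" "inner_unit g g" "1/2" "(1 + \<sigma>) / 2" "\<sigma> / 2"]
      \<sigma> nn[OF f0] nn[OF g] by (simp add: field_simps)
  finally show ?thesis .
qed

text \<open>For f0 and g merely in L2 the product f0 g need not be square integrable; the bound M
  makes it so. The two factors 2 come from (x + y)^2 \<le> 2x^2 + 2y^2, which disposes of the mixed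
  term.\<close>

lemma obs_law_second_moment:
  assumes f0: "f0 \<in> L2_unit" and g: "g \<in> L2_unit" and M: "AE x in lborel. x \<in> {0..1} \<longrightarrow> \<bar>f0 x\<bar> \<le> M"
  shows "(\<integral>\<^sup>+y. ennreal ((snd y * g (fst y))\<^sup>2) \<partial>obs_law \<sigma> f0)
    \<le> ennreal ((2 * M\<^sup>2 + 2 * \<sigma>\<^sup>2) * inner_unit g g)"
proof -
  have [measurable]: "f0 \<in> borel_measurable borel" "g \<in> borel_measurable borel"
    using f0 g by (auto simp: L2_unit_def)
  have "(\<integral>\<^sup>+y. ennreal ((snd y * g (fst y))\<^sup>2) \<partial>obs_law \<sigma> f0)
      = (\<integral>\<^sup>+t\<in>{0..1}. (\<integral>\<^sup>+e. ennreal (((f0 t + \<sigma> * e) * g t)\<^sup>2) \<partial>gauss) \<partial>lborel)"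
    by (subst nn_integral_obs_law) auto
  also have "\<dots> \<le> (\<integral>\<^sup>+t. ennreal (2 * M\<^sup>2 + 2 * \<sigma>\<^sup>2) * (ennreal ((g t)\<^sup>2) * indicator {0..1} t) \<partial>lborel)"
  proof (intro nn_integral_mono_AE, use M in eventually_elim)
    fix t :: real assume t: "t \<in> {0..1} \<longrightarrow> \<bar>f0 t\<bar> \<le> M"
    show "(\<integral>\<^sup>+e. ennreal (((f0 t + \<sigma> * e) * g t)\<^sup>2) \<partial>gauss) * indicator {0..1} t
        \<le> ennreal (2 * M\<^sup>2 + 2 * \<sigma>\<^sup>2) * (ennreal ((g t)\<^sup>2) * indicator {0..1} t)"
    proof (cases "t \<in> {0..1}")
      case True
      have "((f0 t + \<sigma> * e) * g t)\<^sup>2 \<le> 2 * (f0 t)\<^sup>2 * (g t)\<^sup>2 + 2 * \<sigma>\<^sup>2 * (g t)\<^sup>2 * e\<^sup>2" for e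
      proof -
        have "(f0 t + \<sigma> * e)\<^sup>2 \<le> 2 * (f0 t)\<^sup>2 + 2 * (\<sigma> * e)\<^sup>2"
          using sum_squares_bound[of "f0 t" "\<sigma> * e"] by (simp add: power2_sum)
        then have "(f0 t + \<sigma> * e)\<^sup>2 * (g t)\<^sup>2 \<le> (2 * (f0 t)\<^sup>2 + 2 * (\<sigma> * e)\<^sup>2) * (g t)\<^sup>2"
          by (rule mult_right_mono) simp
        then show ?thesis
          unfolding power_mult_distrib[of _ "g t"] by (simp only: power_mult_distrib distrib_right) (simp add: mult_ac)
      qed
      then have "(\<integral>\<^sup>+e. ennreal (((f0 t + \<sigma> * e) * g t)\<^sup>2) \<partial>gauss)
          \<le> (\<integral>\<^sup>+e. ennreal (2 * (f0 t)\<^sup>2 * (g t)\<^sup>2 + 2 * \<sigma>\<^sup>2 * (g t)\<^sup>2 * e\<^sup>2) \<partial>gauss)"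
        by (intro nn_integral_mono ennreal_leI)
      also have "\<dots> = ennreal (2 * (f0 t)\<^sup>2 * (g t)\<^sup>2 + 2 * \<sigma>\<^sup>2 * (g t)\<^sup>2)"
        by (intro nn_integral_gauss_quadratic) auto
      also have "\<dots> \<le> ennreal ((2 * M\<^sup>2 + 2 * \<sigma>\<^sup>2) * (g t)\<^sup>2)"
      proof (intro ennreal_leI)
        have "(f0 t)\<^sup>2 \<le> M\<^sup>2" using t True by (simp add: abs_le_square_iff[symmetric])
        then show "2 * (f0 t)\<^sup>2 * (g t)\<^sup>2 + 2 * \<sigma>\<^sup>2 * (g t)\<^sup>2 \<le> (2 * M\<^sup>2 + 2 * \<sigma>\<^sup>2) * (g t)\<^sup>2"
          by (simp add: distrib_right mult_right_mono)
      qed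
      finally show ?thesis using True by (simp add: ennreal_mult')
    qed simp
  qed
  also have "\<dots> = ennreal (2 * M\<^sup>2 + 2 * \<sigma>\<^sup>2) * ennreal (inner_unit g g)"
    by (simp add: nn_integral_cmult nn_integral_unit_L2 g)
  finally show ?thesis by (simp add: ennreal_mult')
qed

text \<open>Integrating the noise first removes it by Fubini, since it is centred. This makes the
  local coefficients unbiased.\<close>

lemma obs_law_mean:
  assumes f0: "f0 \<in> L2_unit" and g: "g \<in> L2_unit"
    and int: "integrable (obs_law \<sigma> f0) (\<lambda>y. snd y * g (fst y))"
  shows "(\<integral>y. snd y * g (fst y) \<partial>obs_law \<sigma> f0) = inner_unit f0 g"
proof -
  have [measurable]: "f0 \<in> borel_measurable borel" "g \<in> borel_measurable borel"
    using f0 g by (auto simp: L2_unit_def)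
  let ?U = "uniform_measure lborel {0<..<1::real}"
  interpret U: prob_space ?U by (rule prob_space_unit)
  interpret G: prob_space gauss by (rule prob_space_gauss)
  interpret pair_prob_space ?U gauss ..
  have eq: "integrable (?U \<Otimes>\<^sub>M gauss) (\<lambda>(t, e). (f0 t + \<sigma> * e) * g t)"
    using int unfolding obs_law_def
    by (subst (asm) integrable_distr_eq[OF measurable_obs_map]) (auto simp: case_prod_unfold)
  have "(\<integral>y. snd y * g (fst y) \<partial>obs_law \<sigma> f0) = (\<integral>(t, e). (f0 t + \<sigma> * e) * g t \<partial>(?U \<Otimes>\<^sub>M gauss))"
    unfolding obs_law_def by (subst integral_distr[OF measurable_obs_map]) (auto simp: case_prod_unfold)
  also have "\<dots> = (\<integral>t. (\<integral>e. (f0 t + \<sigma> * e) * g t \<partial>gauss) \<partial>?U)"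
    using integral_fst[OF eq] by simp
  also have "\<dots> = (\<integral>t. f0 t * g t \<partial>?U)"
    using gauss_moments G.prob_space by (simp add: distrib_right mult.assoc)
  also have "\<dots> = inner_unit f0 g"
    unfolding uniform_unit_eq_density inner_unit_def set_lebesgue_integral_def
    by (subst integral_density) auto
  finally show ?thesis .
qed

section \<open>Coefficients of one machine and their averages over machines\<close>

lemma prob_space_local_law:
  assumes "f0 \<in> borel_measurable borel"
  shows "prob_space (\<Pi>\<^sub>M l\<in>{1..n div m}. obs_law \<sigma> f0)"
  by (intro prob_space_PiM prob_space_obs_law assms)

lemma sets_local_law:
  "sets (\<Pi>\<^sub>M l\<in>{1..n div m}. obs_law \<sigma> f0) = sets (local_space n m)"
  unfolding local_space_def by (intro sets_PiM_cong sets_obs_law) simp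

lemma sets_data_law [measurable_cong]:
  "sets (data_law n m \<sigma> f0) = sets (\<Pi>\<^sub>M i\<in>{1..m}. local_space n m)"
  unfolding data_law_def by (intro sets_PiM_cong sets_local_law) simp

lemma nn_integral_PiM_component:
  assumes "prob_space M" and "i \<in> I" and "g \<in> borel_measurable M"
  shows "(\<integral>\<^sup>+z. g (z i) \<partial>(\<Pi>\<^sub>M i\<in>I. M)) = (\<integral>\<^sup>+x. g x \<partial>M)"
proof -
  interpret M: prob_space M by fact
  interpret product_prob_space "\<lambda>_. M" I by unfold_locales
  have "(\<integral>\<^sup>+x. g x \<partial>M) = (\<integral>\<^sup>+x. g x \<partial>distr (\<Pi>\<^sub>M i\<in>I. M) M (\<lambda>z. z i))"
    using PiM_component[OF assms(2)] by simp
  also have "\<dots> = (\<integral>\<^sup>+z. g (z i) \<partial>(\<Pi>\<^sub>M i\<in>I. M))"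
    using assms by (intro nn_integral_distr) auto
  finally show ?thesis by simp
qed

lemma measurable_local_coeff:
  assumes [measurable]: "\<psi> j k \<in> borel_measurable borel"
  shows "(\<lambda>z. local_coeff \<psi> n m z j k) \<in> borel_measurable (local_space n m)"
  unfolding local_coeff_def local_space_def by measurable

text \<open>A plain triangle inequality suffices: n/m summands, weighted by m/n, each have the bound
  for a single observation with a basis function of norm 1. The result depends neither on n, m nor
  on (j, k).\<close>

lemma local_coeff_abs_moment:
  assumes f0: "f0 \<in> L2_unit" and \<psi>: "\<psi> j k \<in> L2_unit" "inner_unit (\<psi> j k) (\<psi> j k) = 1"
    and \<sigma>: "\<sigma> \<ge> 0" and nm: "n \<ge> 1" "m dvd n"
  shows "(\<integral>\<^sup>+z. ennreal \<bar>local_coeff \<psi> n m z j k\<bar> \<partial>(\<Pi>\<^sub>M l\<in>{1..n div m}. obs_law \<sigma> f0))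
    \<le> ennreal ((inner_unit f0 f0 + 1) / 2 + \<sigma>)"
proof -
  have [measurable]: "f0 \<in> borel_measurable borel" "\<psi> j k \<in> borel_measurable borel"
    using f0 \<psi> by (auto simp: L2_unit_def)
  let ?O = "obs_law \<sigma> f0" and ?P = "\<Pi>\<^sub>M l\<in>{1..n div m}. obs_law \<sigma> f0"
  define K where "K = (inner_unit f0 f0 + 1) / 2 + \<sigma>"
  have W: "(\<lambda>y. ennreal \<bar>snd y * \<psi> j k (fst y)\<bar>) \<in> borel_measurable ?O" by measurable
  have "(\<integral>\<^sup>+z. ennreal \<bar>local_coeff \<psi> n m z j k\<bar> \<partial>?P)
      \<le> (\<integral>\<^sup>+z. ennreal (real m / real n) * (\<Sum>l=1..n div m. ennreal \<bar>snd (z l) * \<psi> j k (fst (z l))\<bar>) \<partial>?P)"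
  proof (rule nn_integral_mono)
    fix z :: local_data
    have "\<bar>local_coeff \<psi> n m z j k\<bar> \<le> real m / real n * (\<Sum>l=1..n div m. \<bar>snd (z l) * \<psi> j k (fst (z l))\<bar>)"
      unfolding local_coeff_def abs_mult[of "real m / real n"] by (intro mult_mono sum_abs) auto
    then show "ennreal \<bar>local_coeff \<psi> n m z j k\<bar>
        \<le> ennreal (real m / real n) * (\<Sum>l=1..n div m. ennreal \<bar>snd (z l) * \<psi> j k (fst (z l))\<bar>)"
      by (simp add: sum_nonneg ennreal_mult[symmetric] ennreal_leI)
  qed
  also have "\<dots> = ennreal (real m / real n) *
      (\<Sum>l=1..n div m. \<integral>\<^sup>+z. ennreal \<bar>snd (z l) * \<psi> j k (fst (z l))\<bar> \<partial>?P)"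
    by (subst nn_integral_cmult, measurable) (subst nn_integral_sum, measurable)
  also have "\<dots> = ennreal (real m / real n) *
      (\<Sum>l=1..n div m. \<integral>\<^sup>+y. ennreal \<bar>snd y * \<psi> j k (fst y)\<bar> \<partial>?O)"
    by (intro arg_cong2[of _ _ _ _ times] sum.cong refl
        nn_integral_PiM_component[OF prob_space_obs_law _ W]) auto
  also have "\<dots> \<le> ennreal (real m / real n) * (\<Sum>l=1..n div m. ennreal K)"
    using obs_law_abs_moment[OF f0 \<psi>(1) \<sigma>] \<psi>(2) unfolding K_def
    by (intro mult_left_mono sum_mono) (simp_all add: field_simps)
  also have "\<dots> = ennreal K"
    using nm by (simp add: real_of_nat_div ennreal_of_nat_eq_real_of_nat mult.assoc[symmetric]
        ennreal_mult[symmetric] del: ennreal_mult) auto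
  finally show ?thesis unfolding K_def .
qed

text \<open>The average over J is the mean of |J| n/m independent unbiased terms, each with variance
  at most 2M^2 + 2\<sigma>^2. As the data law is a product of products, the variances are added up
  in two stages.\<close>

lemma local_coeff_average_error:
  assumes f0: "f0 \<in> L2_unit" and \<psi>: "\<psi> j k \<in> L2_unit" "inner_unit (\<psi> j k) (\<psi> j k) = 1"
    and M: "AE x in lborel. x \<in> {0..1} \<longrightarrow> \<bar>f0 x\<bar> \<le> M"
    and nm: "n \<ge> 1" "m dvd n" and J: "J \<subseteq> {1..m}" "J \<noteq> {}"
  shows "(\<integral>\<^sup>+z. ennreal (((\<Sum>i\<in>J. local_coeff \<psi> n m (z i) j k) / real (card J) - inner_unit f0 (\<psi> j k))\<^sup>2)
      \<partial>data_law n m \<sigma> f0) \<le> ennreal ((2 * M\<^sup>2 + 2 * \<sigma>\<^sup>2) * real m / (real (card J) * real n))"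
proof -
  have [measurable]: "f0 \<in> borel_measurable borel" "\<psi> j k \<in> borel_measurable borel"
    using f0 \<psi> by (auto simp: L2_unit_def)
  let ?O = "obs_law \<sigma> f0" and ?P = "\<Pi>\<^sub>M l\<in>{1..n div m}. obs_law \<sigma> f0"
  interpret O: prob_space ?O by (rule prob_space_obs_law) measurable
  define v where "v = 2 * M\<^sup>2 + 2 * \<sigma>\<^sup>2"
  define W where "W = (\<lambda>y. snd y * \<psi> j k (fst y))"
  define c where "c = inner_unit f0 (\<psi> j k)"
  define h where "h = (\<lambda>y. W y - c)"
  define H where "H = (\<lambda>w::local_data. \<Sum>l\<in>{1..n div m}. h (w l))"
  have Wm [measurable]: "W \<in> borel_measurable ?O" unfolding W_def by measurable
  have W2: "(\<integral>\<^sup>+y. ennreal ((W y)\<^sup>2) \<partial>?O) \<le> ennreal v"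
    using obs_law_second_moment[OF f0 \<psi>(1) M] \<psi>(2) unfolding W_def v_def by simp
  have intW2: "integrable ?O (\<lambda>y. (W y)\<^sup>2)"
    using W2 by (intro integrableI_bounded) (auto intro: le_less_trans)
  have intW: "integrable ?O W"
    by (rule O.square_integrable_imp_integrable[OF _ intW2]) measurable
  have meanW: "(\<integral>y. W y \<partial>?O) = c"
    using obs_law_mean[OF f0 \<psi>(1)] intW unfolding W_def c_def by simp
  have h1: "integrable ?O h" unfolding h_def using intW by auto
  have h2: "integrable ?O (\<lambda>y. (h y)\<^sup>2)" unfolding h_def power2_diff using intW intW2 by auto
  have h0: "(\<integral>y. h y \<partial>?O) = 0" unfolding h_def using intW meanW O.prob_space by simp
  have "(\<integral>y. (h y)\<^sup>2 \<partial>?O) = (\<integral>y. (W y)\<^sup>2 \<partial>?O) - c\<^sup>2"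
    unfolding h_def power2_diff using intW intW2 meanW O.prob_space
    by (simp add: power2_eq_square)
  moreover have "(\<integral>y. (W y)\<^sup>2 \<partial>?O) \<le> v"
  proof -
    have "0 \<le> v" unfolding v_def by simp
    then show ?thesis using W2 nn_integral_eq_integral[OF intW2] by simp
  qed
  \<comment> \<open>The variance is at most the second moment.\<close>
  ultimately have hv: "(\<integral>y. (h y)\<^sup>2 \<partial>?O) \<le> v" by (smt (z3) zero_le_power2)
  have H1: "integrable ?P H" and H2: "integrable ?P (\<lambda>w. (H w)\<^sup>2)" and H0: "(\<integral>w. H w \<partial>?P) = 0"
    and Hv: "(\<integral>w. (H w)\<^sup>2 \<partial>?P) = real (n div m) * (\<integral>y. (h y)\<^sup>2 \<partial>?O)"
    using iid_sum_moments[OF O.prob_space_axioms finite_atLeastAtMost order_refl h1 h2 h0, of 1 "n div m"]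
    unfolding H_def by simp_all
  have P: "prob_space ?P" by (rule prob_space_local_law) measurable
  \<comment> \<open>Second stage: the machines are independent, and the summand of machine i is the
    centred sum \<open>H\<close>.\<close>
  have S2: "integrable (data_law n m \<sigma> f0) (\<lambda>z. (\<Sum>i\<in>J. H (z i))\<^sup>2)"
    and Sv: "(\<integral>z. (\<Sum>i\<in>J. H (z i))\<^sup>2 \<partial>data_law n m \<sigma> f0) = real (card J) * (\<integral>w. (H w)\<^sup>2 \<partial>?P)"
    using iid_sum_moments(2,4)[OF P finite_atLeastAtMost J(1) H1 H2 H0] unfolding data_law_def by simp_all
  have fJ: "finite J" using J finite_subset by auto
  have cJ: "real (card J) > 0" using fJ J(2) by (simp add: card_gt_0_iff)
  have n': "real (n div m) = real n / real m" using nm by (simp add: real_of_nat_div)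
  have m0: "real m > 0" using J by (cases m) auto
  define \<kappa> where "\<kappa> = real m / real n / real (card J)"
  have lc: "local_coeff \<psi> n m w j k = real m / real n * H w + c" for w
  proof -
    have "H w = (\<Sum>l=1..n div m. W (w l)) - real (n div m) * c"
      unfolding H_def h_def by (simp add: sum_subtractf)
    then show ?thesis using nm m0 unfolding local_coeff_def W_def n' by (simp add: field_simps)
  qed
  have avg: "(\<Sum>i\<in>J. local_coeff \<psi> n m (z i) j k) / real (card J) - c = \<kappa> * (\<Sum>i\<in>J. H (z i))" for z
  proof -
    have "(\<Sum>i\<in>J. local_coeff \<psi> n m (z i) j k) = real m / real n * (\<Sum>i\<in>J. H (z i)) + real (card J) * c"
      unfolding lc sum.distrib sum_distrib_left by simp
    then show ?thesis unfolding \<kappa>_def using cJ by (simp add: field_simps)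
  qed
  have "(\<integral>\<^sup>+z. ennreal ((\<kappa> * (\<Sum>i\<in>J. H (z i)))\<^sup>2) \<partial>data_law n m \<sigma> f0)
      = ennreal (\<integral>z. (\<kappa> * (\<Sum>i\<in>J. H (z i)))\<^sup>2 \<partial>data_law n m \<sigma> f0)"
    unfolding power_mult_distrib using S2 by (intro nn_integral_eq_integral) auto
  also have "(\<integral>z. (\<kappa> * (\<Sum>i\<in>J. H (z i)))\<^sup>2 \<partial>data_law n m \<sigma> f0)
      = \<kappa>\<^sup>2 * (real (card J) * (real (n div m) * (\<integral>y. (h y)\<^sup>2 \<partial>?O)))"
    unfolding power_mult_distrib by (simp only: Sv Hv Bochner_Integration.integral_mult_right_zero)
  also have "\<dots> \<le> \<kappa>\<^sup>2 * (real (card J) * (real (n div m) * v))"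
    by (intro mult_left_mono hv) auto
  also have "\<dots> = v * real m / (real (card J) * real n)"
    unfolding \<kappa>_def n' using cJ m0 nm by (simp add: power2_eq_square field_simps)
  finally show ?thesis
    unfolding v_def c_def[symmetric] avg by (simp add: ennreal_leI)
qed

section \<open>Groups of machines and blocks of coefficients\<close>

definition pair_index :: "nat \<times> nat \<Rightarrow> nat" where
  "pair_index = (\<lambda>(j, k). 2^j + k)"

definition index_pairs :: "(nat \<times> nat) set" where
  "index_pairs = {(j, k). k < 2^j}"

text \<open>For k < 2^j the number 2^j + k lies in the dyadic block from 2^j to 2^(j+1) - 1, and
  these blocks are disjoint.\<close>

lemma inj_pair_index: "inj_on pair_index index_pairs"
proof -
  have le: "j \<le> j'" if "2^j + k = 2^j' + k'" "k' < 2^j'" for j j' k k' :: nat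
  proof (rule ccontr)
    assume "\<not> j \<le> j'"
    then have "(2::nat) ^ Suc j' \<le> 2 ^ j" by (intro power_increasing) auto
    then have "2 * (2::nat) ^ j' \<le> 2 ^ j" unfolding power_Suc .
    then show False using that by linarith
  qed
  have "j = j' \<and> k = k'" if "k < 2^j" "k' < 2^j'" "2^j + k = 2^j' + k'" for j k j' k' :: nat
  proof -
    have "j = j'" using le[OF that(3,2)] le[OF that(3)[symmetric] that(1)] by (rule antisym)
    moreover from this have "k = k'" using that(3) by simp
    ultimately show ?thesis ..
  qed
  then show ?thesis
    unfolding inj_on_def index_pairs_def pair_index_def by (simp only: mem_Collect_eq case_prod_unfold prod_eq_iff) blast
qed

lemma pair_index_image: "pair_index ` index_pairs = {1..}"
proof
  show "pair_index ` index_pairs \<subseteq> {1..}" by (auto simp: pair_index_def Suc_le_eq)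
  show "{1..} \<subseteq> pair_index ` index_pairs"
  proof
    fix p :: nat assume "p \<in> {1..}"
    then obtain j where "2 ^ j \<le> p" "p < 2 ^ (j + 1)" using ex_power_ivl1[of 2 p] by auto
    then show "p \<in> pair_index ` index_pairs"
      by (intro image_eqI[of _ _ "(j, p - 2^j)"]) (auto simp: pair_index_def index_pairs_def)
  qed
qed

lemma index_pairs_upto:
  "bij_betw pair_index {(j, k). k < 2^j \<and> 2^j + k \<le> P} {1..P}"
proof -
  have A: "{(j, k). k < 2^j \<and> 2^j + k \<le> P} = {q \<in> index_pairs. pair_index q \<in> {1..P}}"
    by (simp add: set_eq_iff index_pairs_def pair_index_def Suc_le_eq split_beta)
  have "pair_index ` {q \<in> index_pairs. pair_index q \<in> {1..P}} = {p \<in> pair_index ` index_pairs. p \<in> {1..P}}"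
    by (auto simp only: image_iff mem_Collect_eq)
  also have "\<dots> = {1..P}" unfolding pair_index_image by auto
  finally show ?thesis
    unfolding A bij_betw_def by (intro conjI inj_on_subset[OF inj_pair_index]) auto
qed

lemma finite_index_pairs_upto: "finite {(j, k). k < 2^j \<and> 2^j + k \<le> (P::nat)}"
  using bij_betw_finite[OF index_pairs_upto[of P]] by simp

lemma card_index_pairs_upto: "card {(j, k). k < 2^j \<and> 2^j + k \<le> P} = P"
  using bij_betw_same_card[OF index_pairs_upto[of P]] by simp

section \<open>Matching machines with coefficients\<close>

definition sender_group :: "nat \<Rightarrow> nat \<Rightarrow> nat \<Rightarrow> nat" where
  "sender_group \<eta> m i = nat \<lceil>real i * real \<eta> / real m\<rceil>"

text \<open>Equal to \<open>group_index\<close> plus 1, since groups are numbered from 1.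
  \<open>message\<close> describes the machines of a group by integer floors,
  \<open>central_coeff\<close> by real inequalities; comparing \<open>sender_group\<close> with this
  number expresses both.\<close>

definition coeff_group :: "nat \<Rightarrow> nat \<Rightarrow> nat" where
  "coeff_group b p = nat \<lceil>real p / real b\<rceil>"

lemma nat_ceiling_eq_iff:
  "x > 0 \<Longrightarrow> nat \<lceil>x\<rceil> = l \<longleftrightarrow> real l - 1 < x \<and> x \<le> real l" for x :: real
  by (auto; linarith)

lemma sender_group_eq_iff:
  assumes "1 \<le> i" "1 \<le> \<eta>" "1 \<le> m"
  shows "sender_group \<eta> m i = l \<longleftrightarrow>
    (real l - 1) * real m / real \<eta> < real i \<and> real i \<le> real l * real m / real \<eta>"
  unfolding sender_group_def using assms
  by (subst nat_ceiling_eq_iff) (auto simp: field_simps)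

lemma coeff_group_eq_iff:
  assumes "1 \<le> p" "1 \<le> b"
  shows "coeff_group b p = l \<longleftrightarrow> (l - 1) * b < p \<and> p \<le> l * b"
proof -
  have "coeff_group b p = l \<longleftrightarrow> (real l - 1) * real b < real p \<and> real p \<le> real l * real b"
    unfolding coeff_group_def using assms by (subst nat_ceiling_eq_iff) (auto simp: field_simps)
  also have "\<dots> \<longleftrightarrow> (l - 1) * b < p \<and> p \<le> l * b"
  \<comment> \<open>At l = 0 the truncated \<open>l - 1\<close> differs from
    \<open>real l - 1\<close>, but both sides are false because p \<ge> 1.\<close>
  proof (cases l)
    case (Suc l')
    have "real l' * real b < real p \<longleftrightarrow> l' * b < p" "real (Suc l') * real b \<ge> real p \<longleftrightarrow> p \<le> Suc l' * b"
      by (simp_all only: of_nat_mult[symmetric] of_nat_less_iff of_nat_le_iff)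
    then show ?thesis using Suc by simp
  qed (use assms in simp)
  finally show ?thesis .
qed

lemma coeff_group_range:
  assumes "1 \<le> p" "1 \<le> b" "p \<le> \<eta> * b"
  shows "coeff_group b p \<in> {1..\<eta>}"
proof -
  have "(coeff_group b p - 1) * b < p" "p \<le> coeff_group b p * b"
    using coeff_group_eq_iff[OF assms(1,2)] by auto
  moreover from this have "coeff_group b p \<noteq> 0" using assms by (cases "coeff_group b p") auto
  moreover have "coeff_group b p - 1 < \<eta>"
    using less_le_trans[OF calculation(1) assms(3)] by (rule mult_less_cancel2[THEN iffD1, THEN conjunct2])
  ultimately show ?thesis by auto
qed

lemma message_eq:
  fixes B s L :: real and n m :: nat
  defines "b \<equiv> block_size n B" and "\<eta> \<equiv> num_groups s L n m B"
  assumes b: "1 \<le> b" and \<eta>: "1 \<le> \<eta>" and m: "1 \<le> m" and i: "1 \<le> i" and p: "2^j + k \<le> \<eta> * b"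
    and grp: "sender_group \<eta> m i = coeff_group b (2^j + k)"
  shows "message \<psi> s L n m B i z j k = trans_approx n (local_coeff \<psi> n m z j k)"
proof -
  define l where "l = coeff_group b (2^j + k)"
  have p1: "(1::nat) \<le> 2^j + k" by (simp add: Suc_le_eq)
  have l: "l \<in> {1..\<eta>}" unfolding l_def by (rule coeff_group_range[OF p1 b p])
  have "(l - 1) * b < 2^j + k" "2^j + k \<le> l * b" using coeff_group_eq_iff[OF p1 b, of l] l_def by auto
  moreover have "(real l - 1) * real m / real \<eta> < real i" "real i \<le> real l * real m / real \<eta>"
    using sender_group_eq_iff[OF i \<eta> m, of l] grp l_def by auto
  then have "\<lfloor>real (l - 1) * real m / real \<eta>\<rfloor> + 1 \<le> int i" "int i \<le> \<lfloor>real l * real m / real \<eta>\<rfloor>"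
    using l by (auto simp: of_nat_diff floor_less_iff le_floor_iff add1_zle_eq)
  ultimately show ?thesis
    unfolding message_def Let_def b_def[symmetric] \<eta>_def[symmetric] using l by (intro if_P) blast
qed

definition coeff_machines :: "nat \<Rightarrow> nat \<Rightarrow> nat \<Rightarrow> nat \<Rightarrow> nat set" where
  "coeff_machines b \<eta> m p = {i \<in> {1..m}. sender_group \<eta> m i = coeff_group b p}"

text \<open>The machines over which the centre averages are exactly those that transmit the
  coefficient, so the empty default message never enters the average.\<close>

lemma central_coeff_eq:
  fixes B s L :: real and n m :: nat
  defines "b \<equiv> block_size n B" and "\<eta> \<equiv> num_groups s L n m B"
  assumes b: "1 \<le> b" and \<eta>: "1 \<le> \<eta>" and m: "1 \<le> m" and p: "2^j + k \<le> \<eta> * b"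
  shows "central_coeff \<psi> s L n m B z j k =
    (\<Sum>i\<in>coeff_machines b \<eta> m (2^j + k). trans_value n (trans_approx n (local_coeff \<psi> n m (z i) j k)))
      / real (card (coeff_machines b \<eta> m (2^j + k)))"
proof -
  define \<mu> :: real where "\<mu> = of_int (group_index n B j k)"
  have p1: "(1::nat) \<le> 2^j + k" by (simp add: Suc_le_eq)
  \<comment> \<open>Nonnegativity is needed because \<open>coeff_group\<close> passes through
    \<open>nat\<close> whereas \<open>group_index\<close> is an integer.\<close>
  have "\<lceil>(2 ^ j + real k) / real b\<rceil> \<ge> 0"
    by (metis ceiling_mono ceiling_zero divide_nonneg_nonneg of_nat_0_le_iff add_nonneg_nonneg zero_le_numeral zero_le_power)
  then have \<mu>: "\<mu> = real (coeff_group b (2^j + k)) - 1"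
    unfolding \<mu>_def group_index_def coeff_group_def b_def[symmetric] by simp
  have I: "{i\<in>{1..m}. \<mu> * real m / real \<eta> < real i \<and> real i \<le> (\<mu> + 1) * real m / real \<eta>}
      = coeff_machines b \<eta> m (2^j + k)"
    unfolding coeff_machines_def \<mu> using sender_group_eq_iff[OF _ \<eta> m] by auto
  show ?thesis
    unfolding central_coeff_def Let_def b_def[symmetric] \<eta>_def[symmetric] \<mu>_def[symmetric] I
    using p message_eq[of n B s L m _ j k \<psi>] b \<eta> m
    by (auto simp: coeff_machines_def b_def \<eta>_def intro!: sum.cong arg_cong2[of _ _ _ _ "(/)"])
qed

lemma half_le_floor: "1 \<le> x \<Longrightarrow> x / 2 \<le> of_int \<lfloor>x\<rfloor>" for x :: real
proof -
  assume "1 \<le> x"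
  then have "1 \<le> \<lfloor>x\<rfloor>" by simp
  then have "1 \<le> real_of_int \<lfloor>x\<rfloor>" by simp
  then show ?thesis by linarith
qed

text \<open>A half-open interval of length x = m/\<eta> \<ge> 1 contains at least
  \<lfloor>x\<rfloor> \<ge> x/2 integers. Its right end l x is at most m because l \<le> \<eta>, so
  all these integers are machines.\<close>

lemma card_coeff_machines:
  assumes p: "1 \<le> p" "1 \<le> b" "p \<le> \<eta> * b" and \<eta>: "1 \<le> \<eta>" "\<eta> \<le> m"
  shows "real m / (2 * real \<eta>) \<le> real (card (coeff_machines b \<eta> m p))"
proof -
  define l where "l = coeff_group b p"
  define x where "x = real m / real \<eta>"
  have m: "1 \<le> m" using \<eta> by simp
  have l: "1 \<le> l" "l \<le> \<eta>" using coeff_group_range[OF p] l_def by auto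
  have x: "x \<ge> 1" unfolding x_def using \<eta> by simp
  have lx: "real l * x \<le> real m"
    unfolding x_def using l \<eta> by (simp add: field_simps mult_right_mono)
  have nn: "(real l - 1) * x \<ge> 0" using l x by auto
  have "coeff_machines b \<eta> m p = {nat \<lfloor>(real l - 1) * x\<rfloor><..nat \<lfloor>real l * x\<rfloor>}"
  proof (intro set_eqI iffI)
    fix i assume "i \<in> coeff_machines b \<eta> m p"
    then have "1 \<le> i" "(real l - 1) * x < real i" "real i \<le> real l * x"
      using sender_group_eq_iff[OF _ \<eta>(1) m, of i l] by (auto simp: coeff_machines_def x_def l_def)
    then show "i \<in> {nat \<lfloor>(real l - 1) * x\<rfloor><..nat \<lfloor>real l * x\<rfloor>}"
      using nn by (auto simp: nat_less_iff floor_less_iff le_nat_floor)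
  next
    fix i assume "i \<in> {nat \<lfloor>(real l - 1) * x\<rfloor><..nat \<lfloor>real l * x\<rfloor>}"
    then have i: "1 \<le> i" "(real l - 1) * x < real i" "int i \<le> \<lfloor>real l * x\<rfloor>"
      using nn x by (auto simp: nat_less_iff floor_less_iff le_nat_iff)
    have "real i \<le> real l * x" using i(3) by (simp add: le_floor_iff)
    note i = i(1,2) this
    then have "i \<le> m" using lx by linarith
    then show "i \<in> coeff_machines b \<eta> m p"
      using i sender_group_eq_iff[OF i(1) \<eta>(1) m, of l] by (auto simp: coeff_machines_def x_def l_def)
  qed
  then have "real (card (coeff_machines b \<eta> m p)) = real (nat \<lfloor>real l * x\<rfloor> - nat \<lfloor>(real l - 1) * x\<rfloor>)"
    by simp
  moreover have "\<lfloor>real l * x\<rfloor> \<ge> \<lfloor>(real l - 1) * x\<rfloor> + \<lfloor>x\<rfloor>"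
    using le_floor_add[of "(real l - 1) * x" x] by (simp add: algebra_simps)
  ultimately have "real (card (coeff_machines b \<eta> m p)) \<ge> of_int \<lfloor>x\<rfloor>"
    using nn x by (simp add: nat_diff_distrib[symmetric]) linarith
  moreover have "of_int \<lfloor>x\<rfloor> \<ge> x / 2" by (rule half_le_floor[OF x])
  ultimately show ?thesis unfolding x_def by simp
qed

section \<open>Membership in the class of distributed estimators\<close>

lemma block_size_le:
  assumes "log 2 (real n) > 0" "B \<ge> 0"
  shows "real (block_size n B) * log 2 (real n) \<le> B"
proof -
  have "real (block_size n B) \<le> B / log 2 (real n)"
    unfolding block_size_def using assms by simp
  then show ?thesis using assms by (simp add: field_simps)
qed

text \<open>Each machine concatenates the codes of the b coefficients of its block. One code costs
  on average at most 5 + (1/2) log_2 n plus four times the first absolute moment of the coefficient;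
  the last assumption on K, true for large n, makes this at most log_2 n, and b log_2 n \<le>
  B.\<close>

lemma dist_estimator_mem:
  fixes B s L :: real and n m :: nat
  defines "b \<equiv> block_size n B" and "\<eta> \<equiv> num_groups s L n m B"
  assumes \<psi>: "orthonormal_basis_unit \<psi>" and \<sigma>: "\<sigma> \<ge> 0"
    and nm: "n \<ge> 1" "m dvd n" "1 \<le> m"
    and b: "1 \<le> b" and \<eta>: "1 \<le> \<eta>" and B: "B \<ge> 0"
    and F: "\<And>f. f \<in> F \<Longrightarrow> f \<in> L2_unit \<and> inner_unit f f \<le> K"
    and K: "0 \<le> K" "5 + 4 * ((K + 1) / 2 + \<sigma>) \<le> (1/2) * log 2 (real n)"
  shows "dist_estimator \<psi> s L n m B \<in> dist_estimators n m \<sigma> (\<lambda>_. B) F"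
proof -
  define c where "c = nat (trans_cutoff n)"
  define pr where "pr = inv_into index_pairs pair_index"
  \<comment> \<open>The interval excludes its right end: group l sends the indices from (l-1)b + 1
    to l b.\<close>
  define blk where "blk i = [(sender_group \<eta> m i - 1) * b + 1..<sender_group \<eta> m i * b + 1]" for i
  define msg where "msg p w = trans_approx n (local_coeff \<psi> n m w (fst (pr p)) (snd (pr p)))" for p w
  define Y where "Y i w = concat (map (prefix_code c) (map (\<lambda>p. msg p w) (blk i)))" for i w
  define A where "A = {(j, k). k < 2^j \<and> 2^j + k \<le> \<eta> * b}"
  \<comment> \<open>The coefficient with index p sits at the position p - 1 - (l-1)b, counted from
    0, in the message of group l. So the index itself need not be transmitted.\<close>
  define d where "d i p y = trans_value n (prefix_decode c (p - 1 - (sender_group \<eta> m i - 1) * b) y)" for i p y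
  define g where "g y x = (\<Sum>(j, k)\<in>A. (\<Sum>i\<in>coeff_machines b \<eta> m (2^j + k). d i (2^j + k) (y i))
      / real (card (coeff_machines b \<eta> m (2^j + k))) * \<psi> j k x)" for y x
  have pr: "snd (pr p) < 2 ^ fst (pr p)" if "1 \<le> p" for p
  proof -
    have "pr p \<in> index_pairs" unfolding pr_def using that pair_index_image by (intro inv_into_into) auto
    then show ?thesis by (auto simp: index_pairs_def)
  qed
  have pr_eq: "pr (2^j + k) = (j, k)" if "k < 2^j" for j k
    using inv_into_f_f[OF inj_pair_index, of "(j, k)"] that by (simp add: pr_def index_pairs_def pair_index_def)
  have \<psi>m: "\<psi> j k \<in> borel_measurable borel" if "k < 2^j" for j k
    using orthonormal_basis_unitD(1)[OF \<psi> that] by (simp add: L2_unit_def)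
  have blk1: "1 \<le> p" if "p \<in> set (blk i)" for i p
    using that unfolding blk_def by (auto simp del: upt_Suc)
  have msg_meas: "(\<lambda>w. msg p w) \<in> local_space n m \<rightarrow>\<^sub>M count_space UNIV" if "1 \<le> p" for p
    unfolding msg_def
    by (rule measurable_compose[OF measurable_local_coeff measurable_trans_approx]) (rule \<psi>m[OF pr[OF that]])
  have Y_meas: "Y i \<in> local_space n m \<rightarrow>\<^sub>M count_space UNIV" for i
  proof -
    have "(\<lambda>w. map (\<lambda>p. msg p w) (blk i)) \<in> local_space n m \<rightarrow>\<^sub>M count_space UNIV"
      using blk1 by (intro measurable_map_count_space msg_meas)
    then show ?thesis unfolding Y_def[abs_def] by (rule measurable_compose) simp
  qed
  have g_meas: "(\<lambda>(y, x). g y x) \<in> borel_measurable ((\<Pi>\<^sub>M i\<in>{1..m}. count_space UNIV) \<Otimes>\<^sub>M borel)"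
  proof -
    let ?N = "(\<Pi>\<^sub>M i\<in>{1..m}. count_space (UNIV :: bool list set)) \<Otimes>\<^sub>M (borel :: real measure)"
    have 1: "(\<lambda>yx. d i p (fst yx i)) \<in> borel_measurable ?N" if "i \<in> {1..m}" for i p
    proof -
      have "(\<lambda>yx. fst yx i) \<in> ?N \<rightarrow>\<^sub>M count_space UNIV" using that by measurable
      then show ?thesis by (rule measurable_compose) simp
    qed
    have 2: "(\<lambda>yx. \<psi> j k (snd yx)) \<in> borel_measurable ?N" if "(j, k) \<in> A" for j k
      using that by (intro measurable_compose[OF measurable_snd \<psi>m]) (auto simp: A_def)
    show ?thesis
      unfolding g_def case_prod_unfold
      by (intro borel_measurable_sum borel_measurable_times borel_measurable_divide 1 2)
        (auto simp: coeff_machines_def)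
  qed
  have g_L2: "g y \<in> L2_unit" for y
    unfolding g_def[abs_def] case_prod_unfold
    by (intro L2_unit_sum L2_unit_scale orthonormal_basis_unitD[OF \<psi>]) (auto simp: A_def)
  have fh: "dist_estimator \<psi> s L n m B z = g (\<lambda>i\<in>{1..m}. Y i (z i))" for z
  proof
    fix x
    have dec: "d i (2^j + k) (Y i (z i)) = trans_value n (trans_approx n (local_coeff \<psi> n m (z i) j k))"
      if jk: "(j, k) \<in> A" and i: "i \<in> coeff_machines b \<eta> m (2^j + k)" for i j k
    proof -
      define p where "p = 2^j + k"
      define l where "l = sender_group \<eta> m i"
      have p1: "1 \<le> p" unfolding p_def by (simp add: Suc_le_eq)
      have lp: "(l - 1) * b < p" "p \<le> l * b"
        using coeff_group_eq_iff[OF p1 b, of l] i by (auto simp: coeff_machines_def p_def l_def)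
      have "1 \<le> l" using lp p1 by (cases l) auto
      then have lb: "l * b = (l - 1) * b + b" by (cases l) auto
      have r: "p - 1 - (l - 1) * b < length (blk i)" "blk i ! (p - 1 - (l - 1) * b) = p"
        unfolding blk_def l_def[symmetric] using lp lb by (auto simp del: upt_Suc)
      have "d i p (Y i (z i)) = trans_value n (msg p (z i))"
        unfolding d_def Y_def l_def[symmetric] using r
        by (subst prefix_decode_concat) (simp_all add: trans_value_pad_bits)
      then show ?thesis using jk unfolding p_def msg_def by (simp add: pr_eq A_def)
    qed
    have "dist_estimator \<psi> s L n m B z x = (\<Sum>(j, k)\<in>A. central_coeff \<psi> s L n m B z j k * \<psi> j k x)"
      unfolding dist_estimator_def A_def b_def \<eta>_def ..
    also have "\<dots> = g (\<lambda>i\<in>{1..m}. Y i (z i)) x"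
      unfolding g_def
    proof (rule sum.cong[OF refl], clarify)
      fix j k assume jk: "(j, k) \<in> A"
      have "central_coeff \<psi> s L n m B z j k =
          (\<Sum>i\<in>coeff_machines b \<eta> m (2^j + k). trans_value n (trans_approx n (local_coeff \<psi> n m (z i) j k)))
          / real (card (coeff_machines b \<eta> m (2^j + k)))"
        unfolding b_def \<eta>_def
        by (rule central_coeff_eq) (use b \<eta> nm jk in \<open>auto simp: A_def b_def \<eta>_def\<close>)
      also have "(\<Sum>i\<in>coeff_machines b \<eta> m (2^j + k). trans_value n (trans_approx n (local_coeff \<psi> n m (z i) j k)))
          = (\<Sum>i\<in>coeff_machines b \<eta> m (2^j + k). d i (2^j + k) ((\<lambda>i\<in>{1..m}. Y i (z i)) i))"
        by (rule sum.cong) (auto simp: dec[OF jk] coeff_machines_def)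
      finally show "central_coeff \<psi> s L n m B z j k * \<psi> j k x =
          (\<Sum>i\<in>coeff_machines b \<eta> m (2^j + k). d i (2^j + k) ((\<lambda>i\<in>{1..m}. Y i (z i)) i))
          / real (card (coeff_machines b \<eta> m (2^j + k))) * \<psi> j k x" by simp
    qed
    finally show "dist_estimator \<psi> s L n m B z x = g (\<lambda>i\<in>{1..m}. Y i (z i)) x" .
  qed
  have bits: "(\<integral>\<^sup>+z. ennreal (real (length (Y i (z i)))) \<partial>data_law n m \<sigma> f0) \<le> ennreal B"
    if f0: "f0 \<in> F" and i: "i \<in> {1..m}" for f0 i
  proof -
    let ?P = "\<Pi>\<^sub>M l\<in>{1..n div m}. obs_law \<sigma> f0"
    have f0L: "f0 \<in> L2_unit" and f0K: "inner_unit f0 f0 \<le> K" using F[OF f0] by auto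
    then have f0m: "f0 \<in> borel_measurable borel" by (simp add: L2_unit_def)
    interpret P: prob_space ?P by (rule prob_space_local_law[OF f0m])
    have lm: "(\<lambda>w. ennreal \<bar>local_coeff \<psi> n m w (fst (pr p)) (snd (pr p))\<bar>) \<in> borel_measurable ?P"
      if "1 \<le> p" for p
      unfolding measurable_cong_sets[OF sets_local_law refl]
      using measurable_local_coeff[of \<psi> "fst (pr p)" "snd (pr p)", OF \<psi>m[OF pr[OF that]]] by measurable
    have len: "(\<lambda>w. ennreal (real (length (Y i w)))) \<in> borel_measurable ?P"
      unfolding measurable_cong_sets[OF sets_local_law refl]
      by (rule measurable_compose[OF Y_meas]) simp
    have "(\<integral>\<^sup>+z. ennreal (real (length (Y i (z i)))) \<partial>data_law n m \<sigma> f0)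
        = (\<integral>\<^sup>+w. ennreal (real (length (Y i w))) \<partial>?P)"
      unfolding data_law_def using P.prob_space_axioms i len by (rule nn_integral_PiM_component)
    also have "\<dots> \<le> (\<integral>\<^sup>+w. (\<Sum>p\<in>set (blk i). ennreal (5 + (1/2) * log 2 (real n)) +
        ennreal 4 * ennreal \<bar>local_coeff \<psi> n m w (fst (pr p)) (snd (pr p))\<bar>) \<partial>?P)"
    proof (rule nn_integral_mono)
      fix w
      have "real (length (Y i w)) = (\<Sum>p\<in>set (blk i). real (length (prefix_code c (msg p w))))"
        unfolding Y_def by (simp add: length_concat comp_def blk_def sum_list_distinct_conv_sum_set
            del: upt_Suc flip: of_nat_sum)
      also have "\<dots> \<le> (\<Sum>p\<in>set (blk i). (5 + (1/2) * log 2 (real n)) +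
          4 * \<bar>local_coeff \<psi> n m w (fst (pr p)) (snd (pr p))\<bar>)"
        unfolding c_def msg_def by (intro sum_mono length_prefix_code_trans_approx_le nm)
      finally have "ennreal (real (length (Y i w))) \<le> ennreal (\<Sum>p\<in>set (blk i). (5 + (1/2) * log 2 (real n)) +
          4 * \<bar>local_coeff \<psi> n m w (fst (pr p)) (snd (pr p))\<bar>)" by (rule ennreal_leI)
      also have "\<dots> = (\<Sum>p\<in>set (blk i). ennreal (5 + (1/2) * log 2 (real n)) +
          ennreal 4 * ennreal \<bar>local_coeff \<psi> n m w (fst (pr p)) (snd (pr p))\<bar>)"
        using nm by (subst sum_ennreal[symmetric]) (auto simp: ennreal_mult intro!: sum.cong)
      finally show "ennreal (real (length (Y i w))) \<le> \<dots>" .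
    qed
    also have "\<dots> = (\<Sum>p\<in>set (blk i). ennreal (5 + (1/2) * log 2 (real n)) +
        ennreal 4 * (\<integral>\<^sup>+w. ennreal \<bar>local_coeff \<psi> n m w (fst (pr p)) (snd (pr p))\<bar> \<partial>?P))"
      using lm blk1 by (subst nn_integral_sum)
        (auto intro!: sum.cong simp: nn_integral_add nn_integral_cmult P.emeasure_space_1 simp del: One_nat_def)
    also have "\<dots> \<le> (\<Sum>p\<in>set (blk i). ennreal (log 2 (real n)))"
    proof (rule sum_mono)
      fix p assume "p \<in> set (blk i)"
      then have p: "snd (pr p) < 2 ^ fst (pr p)" using pr blk1 by blast
      have "(\<integral>\<^sup>+w. ennreal \<bar>local_coeff \<psi> n m w (fst (pr p)) (snd (pr p))\<bar> \<partial>?P)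
          \<le> ennreal ((inner_unit f0 f0 + 1) / 2 + \<sigma>)"
        using orthonormal_basis_unitD[OF \<psi>] p by (intro local_coeff_abs_moment f0L \<sigma> nm) auto
      also have "\<dots> \<le> ennreal ((K + 1) / 2 + \<sigma>)" using f0K by (intro ennreal_leI) simp
      finally have "ennreal (5 + (1/2) * log 2 (real n)) +
          ennreal 4 * (\<integral>\<^sup>+w. ennreal \<bar>local_coeff \<psi> n m w (fst (pr p)) (snd (pr p))\<bar> \<partial>?P)
          \<le> ennreal (5 + (1/2) * log 2 (real n)) + ennreal 4 * ennreal ((K + 1) / 2 + \<sigma>)"
        by (intro add_left_mono mult_left_mono) auto
      also have "\<dots> = ennreal ((5 + (1/2) * log 2 (real n)) + 4 * ((K + 1) / 2 + \<sigma>))"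
        using nm K \<sigma> by (intro ennreal_affine) auto
      also have "\<dots> \<le> ennreal (log 2 (real n))" by (intro ennreal_leI) (use K in linarith)
      finally show "ennreal (5 + (1/2) * log 2 (real n)) +
          ennreal 4 * (\<integral>\<^sup>+w. ennreal \<bar>local_coeff \<psi> n m w (fst (pr p)) (snd (pr p))\<bar> \<partial>?P)
          \<le> ennreal (log 2 (real n))" .
    qed
    also have "\<dots> = ennreal (real (card (set (blk i))) * log 2 (real n))"
      using nm by (simp add: ennreal_of_nat_eq_real_of_nat ennreal_mult[symmetric])
    also have "\<dots> \<le> ennreal (real b * log 2 (real n))"
    proof (intro ennreal_leI mult_right_mono)
      have "card (set (blk i)) \<le> b"
        unfolding blk_def by (cases "sender_group \<eta> m i") (auto simp: card_atLeastLessThan simp del: upt_Suc)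
      then show "real (card (set (blk i))) \<le> real b" by simp
    qed (use nm in auto)
    also have "\<dots> \<le> ennreal B"
      unfolding b_def using K \<sigma> B by (intro ennreal_leI block_size_le) (auto simp: field_simps)
    finally show ?thesis .
  qed
  show ?thesis
    unfolding dist_estimators_def using Y_meas g_meas g_L2 fh bits
    by (intro CollectI exI[of _ Y] exI[of _ g]) auto
qed

section \<open>Risk and rate\<close>

text \<open>Pythagoras splits the loss into the errors of \<eta> b coefficients and a deterministic
  tail, bounded by T. With v = 2M^2 + 2\<sigma>^2 and at least m/(2\<eta>) machines per coefficient,
  averaging contributes 2v\<eta>/n; adding the truncation error through (x + y)^2 \<le> 2x^2 + 2y^2
  gives 8/n + 4v\<eta>/n.\<close>

lemma dist_estimator_risk:
  fixes B s L M T :: real and n m :: nat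
  defines "b \<equiv> block_size n B" and "\<eta> \<equiv> num_groups s L n m B"
  assumes \<psi>: "orthonormal_basis_unit \<psi>" and f0: "f0 \<in> L2_unit"
    and M: "AE x in lborel. x \<in> {0..1} \<longrightarrow> \<bar>f0 x\<bar> \<le> M"
    and nm: "n \<ge> 1" "m dvd n" "1 \<le> m" and b: "1 \<le> b" and \<eta>: "1 \<le> \<eta>"
    and T: "0 \<le> T" "inner_unit f0 f0 -
      (\<Sum>(j, k) | k < 2^j \<and> 2^j + k \<le> \<eta> * b. (inner_unit f0 (\<psi> j k))\<^sup>2) \<le> T"
  shows "risk n m \<sigma> (dist_estimator \<psi> s L n m B) f0 \<le>
    ennreal (real (\<eta> * b) * ((8 + 4 * (2 * M\<^sup>2 + 2 * \<sigma>\<^sup>2)) * real \<eta> / real n) + T)"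
proof -
  define v where "v = 2 * M\<^sup>2 + 2 * \<sigma>\<^sup>2"
  define A where "A = {(j, k). k < 2^j \<and> 2^j + k \<le> \<eta> * b}"
  define a where "a z = (\<lambda>(j, k). central_coeff \<psi> s L n m B z j k)" for z
  define c where "c = (\<lambda>(j, k). inner_unit f0 (\<psi> j k))"
  have finA: "finite A" and cardA: "card A = \<eta> * b"
    unfolding A_def by (rule finite_index_pairs_upto card_index_pairs_upto)+
  have A\<psi>: "\<psi> (fst q) (snd q) \<in> L2_unit" if "q \<in> A" for q
    using that orthonormal_basis_unitD(1)[OF \<psi>] by (auto simp: A_def)
  have \<eta>m: "\<eta> \<le> m" unfolding \<eta>_def num_groups_def by simp
  have v0: "v \<ge> 0" unfolding v_def by simp
  let ?D = "data_law n m \<sigma> f0"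
  let ?I = "\<lambda>q. coeff_machines b \<eta> m (pair_index q)"
  let ?x = "\<lambda>z q i. local_coeff \<psi> n m (z i) (fst q) (snd q)"
  have a_eq: "a z q = (\<Sum>i\<in>?I q. trans_value n (trans_approx n (?x z q i))) / real (card (?I q))"
    if "q \<in> A" for z q
    using that central_coeff_eq[of n B s L m "fst q" "snd q" \<psi> z] b \<eta> nm
    by (auto simp: a_def A_def b_def \<eta>_def pair_index_def split: prod.splits)
  have lm: "(\<lambda>z. ?x z q i) \<in> borel_measurable ?D" if "q \<in> A" "i \<in> {1..m}" for q i
  proof -
    have "(\<lambda>z. z i) \<in> (\<Pi>\<^sub>M i\<in>{1..m}. local_space n m) \<rightarrow>\<^sub>M local_space n m" using that by measurable
    then have "(\<lambda>z. ?x z q i) \<in> borel_measurable (\<Pi>\<^sub>M i\<in>{1..m}. local_space n m)"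
      using A\<psi>[OF that(1)] by (intro measurable_compose[OF _ measurable_local_coeff]) (auto simp: L2_unit_def)
    then show ?thesis using measurable_cong_sets[OF sets_data_law refl] by blast
  qed
  have am: "(\<lambda>z. ennreal ((a z q - c q)\<^sup>2)) \<in> borel_measurable ?D" if q: "q \<in> A" for q
  proof -
    have "(\<lambda>z. trans_value n (trans_approx n (?x z q i))) \<in> borel_measurable ?D" if "i \<in> ?I q" for i
    proof -
      have "(\<lambda>z. trans_approx n (?x z q i)) \<in> ?D \<rightarrow>\<^sub>M count_space UNIV"
        using that by (intro measurable_compose[OF lm[OF q] measurable_trans_approx]) (auto simp: coeff_machines_def)
      then show ?thesis by (rule measurable_compose) simp
    qed
    then have [measurable]: "(\<lambda>z. a z q) \<in> borel_measurable ?D"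
      unfolding a_eq[OF q] by (intro borel_measurable_divide borel_measurable_sum) auto
    show ?thesis by measurable
  qed
  have coeff: "(\<integral>\<^sup>+z. ennreal ((a z q - c q)\<^sup>2) \<partial>?D) \<le> ennreal ((8 + 4 * v) * real \<eta> / real n)"
    if q: "q \<in> A" for q
  proof -
    define J where "J = ?I q"
    \<comment> \<open>The average of the local coefficients before truncation; it separates the
      rounding error from the statistical error.\<close>
    define y where "y z = (\<Sum>i\<in>J. ?x z q i) / real (card J)" for z
    have p: "1 \<le> pair_index q" "pair_index q \<le> \<eta> * b"
      using q by (auto simp: A_def pair_index_def Suc_le_eq)
    have cJ: "real m / (2 * real \<eta>) \<le> real (card J)"
      unfolding J_def by (rule card_coeff_machines[OF p(1) b p(2) \<eta> \<eta>m])
    have cJ0: "real (card J) > 0"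
      by (rule less_le_trans[OF _ cJ]) (use nm \<eta> in simp)
    have J: "J \<noteq> {}" "J \<subseteq> {1..m}"
      using cJ0 by auto (auto simp: J_def coeff_machines_def)
    have ay: "\<bar>a z q - y z\<bar> \<le> 2 / sqrt (real n)" for z
    proof -
      have "\<bar>a z q - y z\<bar> = \<bar>\<Sum>i\<in>J. trans_value n (trans_approx n (?x z q i)) - ?x z q i\<bar> / real (card J)"
        unfolding a_eq[OF q] y_def J_def[symmetric] using cJ0
        by (simp add: diff_divide_distrib[symmetric] sum_subtractf)
      also have "\<dots> \<le> (\<Sum>i\<in>J. 2 / sqrt (real n)) / real (card J)"
        using cJ0 by (intro divide_right_mono order_trans[OF sum_abs] sum_mono trans_approx_error nm) auto
      also have "\<dots> = 2 / sqrt (real n)" using cJ0 by simp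
      finally show ?thesis .
    qed
    have "(\<integral>\<^sup>+z. ennreal ((y z - c q)\<^sup>2) \<partial>?D) \<le> ennreal (v * real m / (real (card J) * real n))"
      using local_coeff_average_error[where \<psi>=\<psi> and j="fst q" and k="snd q" and \<sigma>=\<sigma>,
          OF f0 A\<psi>[OF q] _ M nm(1,2) J(2,1)] orthonormal_basis_unitD(2)[OF \<psi>] q
      unfolding y_def c_def v_def case_prod_unfold by (auto simp: A_def)
    also have "\<dots> \<le> ennreal (2 * v * real \<eta> / real n)"
    proof (rule ennreal_leI)
      have "real m / real (card J) \<le> 2 * real \<eta>" using cJ cJ0 \<eta> by (simp add: field_simps)
      then have "v * (real m / real (card J)) / real n \<le> v * (2 * real \<eta>) / real n"
        using v0 by (intro divide_right_mono mult_left_mono) auto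
      then show "v * real m / (real (card J) * real n) \<le> 2 * v * real \<eta> / real n"
        by (simp add: mult_ac)
    qed
    finally have yq: "(\<integral>\<^sup>+z. ennreal ((y z - c q)\<^sup>2) \<partial>?D) \<le> ennreal (2 * v * real \<eta> / real n)" .
    have "(a z q - c q)\<^sup>2 \<le> 8 / real n + 2 * (y z - c q)\<^sup>2" for z
    proof -
      have "(a z q - y z)\<^sup>2 \<le> (2 / sqrt (real n))\<^sup>2"
        using ay[of z] by (intro abs_le_square_iff[THEN iffD1]) auto
      then have "(a z q - y z)\<^sup>2 \<le> 4 / real n" by (simp add: power_divide)
      moreover have "(a z q - c q)\<^sup>2 \<le> 2 * (a z q - y z)\<^sup>2 + 2 * (y z - c q)\<^sup>2"
        using sum_squares_bound[of "a z q - y z" "y z - c q"] power2_sum[of "a z q - y z" "y z - c q"] by simp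
      ultimately show ?thesis by simp
    qed
    then have "(\<integral>\<^sup>+z. ennreal ((a z q - c q)\<^sup>2) \<partial>?D)
        \<le> (\<integral>\<^sup>+z. ennreal (8 / real n) + ennreal 2 * ennreal ((y z - c q)\<^sup>2) \<partial>?D)"
      by (intro nn_integral_mono) (subst ennreal_affine, auto intro: ennreal_leI simp del: ennreal_plus)
    also have "\<dots> = ennreal (8 / real n) + ennreal 2 * (\<integral>\<^sup>+z. ennreal ((y z - c q)\<^sup>2) \<partial>?D)"
    proof -
      have "prob_space ?D"
        unfolding data_law_def using f0 by (intro prob_space_PiM prob_space_local_law) (auto simp: L2_unit_def)
      moreover have [measurable]: "y \<in> borel_measurable ?D"
        unfolding y_def[abs_def] using J by (intro borel_measurable_divide borel_measurable_sum lm q) auto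
      ultimately show ?thesis
        by (simp add: nn_integral_add nn_integral_cmult prob_space.emeasure_space_1)
    qed
    also have "\<dots> \<le> ennreal (8 / real n) + ennreal 2 * ennreal (2 * v * real \<eta> / real n)"
      by (intro add_left_mono mult_left_mono yq) simp
    also have "\<dots> = ennreal (8 / real n + 2 * (2 * v * real \<eta> / real n))"
      using v0 by (intro ennreal_affine) auto
    also have "\<dots> \<le> ennreal ((8 + 4 * v) * real \<eta> / real n)"
    proof (intro ennreal_leI)
      \<comment> \<open>The rounding error is absorbed using \<eta> \<ge> 1.\<close>
      have "8 / real n \<le> 8 * real \<eta> / real n" using \<eta> by (intro divide_right_mono) auto
      then show "8 / real n + 2 * (2 * v * real \<eta> / real n) \<le> (8 + 4 * v) * real \<eta> / real n"
        by (simp add: algebra_simps add_divide_distrib)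
    qed
    finally show ?thesis .
  qed
  have "risk n m \<sigma> (dist_estimator \<psi> s L n m B) f0 \<le>
      (\<integral>\<^sup>+z. (\<Sum>q\<in>A. ennreal ((a z q - c q)\<^sup>2)) + ennreal T \<partial>?D)"
    unfolding risk_def
  proof (rule nn_integral_mono)
    fix z
    let ?S = "\<lambda>x. \<Sum>q\<in>A. a z q * \<psi> (fst q) (snd q) x"
    have fh: "dist_estimator \<psi> s L n m B z = ?S"
      unfolding dist_estimator_def A_def a_def b_def \<eta>_def by (simp add: case_prod_unfold)
    have d: "(\<lambda>x. ?S x - f0 x) \<in> L2_unit"
      using L2_unit_add[OF L2_unit_sum L2_unit_scale[OF f0, of "-1"], of A "\<lambda>q x. a z q * \<psi> (fst q) (snd q) x"]
        L2_unit_scale A\<psi> by simp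
    have "(\<integral>\<^sup>+x\<in>{0..1}. ennreal ((?S x - f0 x)\<^sup>2) \<partial>lborel) = ennreal (LINT x:{0..1}|lborel. (?S x - f0 x)\<^sup>2)"
      using nn_integral_unit_L2[OF d] by (simp add: inner_unit_def power2_eq_square)
    also have "(LINT x:{0..1}|lborel. (?S x - f0 x)\<^sup>2)
        = (\<Sum>q\<in>A. (a z q - c q)\<^sup>2) + (inner_unit f0 f0 - (\<Sum>q\<in>A. (c q)\<^sup>2))"
      unfolding c_def case_prod_unfold using orthonormal_basis_unitD(2)[OF \<psi>]
      by (intro sum_orthonormal_square_diff finA A\<psi> f0) (auto simp: A_def prod_eq_iff)
    also have "\<dots> \<le> (\<Sum>q\<in>A. (a z q - c q)\<^sup>2) + T"
      using T(2) by (simp add: A_def c_def case_prod_unfold)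
    also have "ennreal \<dots> = (\<Sum>q\<in>A. ennreal ((a z q - c q)\<^sup>2)) + ennreal T"
      using T(1) by (simp add: sum_nonneg)
    finally show "(\<integral>\<^sup>+x\<in>{0..1}. ennreal ((dist_estimator \<psi> s L n m B z x - f0 x)\<^sup>2) \<partial>lborel)
        \<le> (\<Sum>q\<in>A. ennreal ((a z q - c q)\<^sup>2)) + ennreal T"
      unfolding fh by (simp add: ennreal_leI)
  qed
  also have "\<dots> = (\<Sum>q\<in>A. \<integral>\<^sup>+z. ennreal ((a z q - c q)\<^sup>2) \<partial>?D) + ennreal T"
  proof -
    have "prob_space ?D"
      unfolding data_law_def using f0 by (intro prob_space_PiM prob_space_local_law) (auto simp: L2_unit_def)
    then show ?thesis
      using am by (subst nn_integral_add, simp, simp, subst nn_integral_sum)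
        (simp_all add: prob_space.emeasure_space_1 del: sum_ennreal)
  qed
  also have "\<dots> \<le> (\<Sum>q\<in>A. ennreal ((8 + 4 * v) * real \<eta> / real n)) + ennreal T"
    by (intro add_right_mono sum_mono coeff)
  also have "\<dots> = ennreal T + ennreal (real (\<eta> * b)) * ennreal ((8 + 4 * v) * real \<eta> / real n)"
    by (simp only: sum_constant cardA ennreal_of_nat_eq_real_of_nat add.commute)
  also have "\<dots> = ennreal (T + real (\<eta> * b) * ((8 + 4 * v) * real \<eta> / real n))"
    using v0 T(1) by (intro ennreal_affine) auto
  finally show ?thesis unfolding v_def by (simp only: add.commute[of T])
qed

text \<open>In the logarithms of L, n, l and B all four claims become linear. They concern, in this
  order, the stochastic error, the squared bias for the deflated X, the positivity of
  \<lfloor>X\<rfloor> (from the upper bound on B), and the cap m (from the lower bound on B): up to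
  a power of L the deflated X stays below m.\<close>

lemma rate_exponents:
  fixes s L n l B :: real
  assumes s: "s > 0" and L: "L > 0" and n: "n > 0" and l: "l \<ge> 1" and B: "B > 0"
  defines "X \<equiv> (L\<^sup>2 * n) powr (1 / (2 + 2 * s)) * (l / B) powr ((1 + 2 * s) / (2 + 2 * s))"
    and "R \<equiv> L powr (4 / (2 + 2 * s)) * l powr (2 * s) *
      (n powr (1 / (1 + 2 * s)) / (B * l)) powr (2 * s / (2 + 2 * s)) * n powr (- (2 * s / (1 + 2 * s)))"
  shows "X\<^sup>2 * (B / l) / n \<le> R"
    and "L\<^sup>2 * (X * l powr (- (2 * s / (2 + 2 * s))) * (B / l)) powr (- (2 * s)) = R"
    and "B < n powr (1 / (1 + 2 * s)) / l \<Longrightarrow> 1 / L \<le> l \<Longrightarrow> 1 \<le> X"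
    and "m > 0 \<Longrightarrow> (n * l / m powr (2 + 2 * s)) powr (1 / (1 + 2 * s)) \<le> B \<Longrightarrow>
      L powr (- (2 / (2 + 2 * s))) * X * l powr (- (2 * s / (2 + 2 * s))) \<le> m"
proof -
  define a where "a = ln L"
  define p where "p = ln n"
  define q where "q = ln l"
  define r where "r = ln B"
  have ex: "L = exp a" "n = exp p" "l = exp q" "B = exp r"
    using L n l B by (auto simp: a_def p_def q_def r_def)
  have q0: "q \<ge> 0" unfolding q_def using l by simp
  have pos: "1 + 2 * s > 0" "2 + 2 * s > 0" using s by auto
  \<comment> \<open>Treating 1/(2+2s) as a symbol with one relation turns the identities of
    exponents into polynomial ones that \<open>algebra\<close> can decide.\<close>
  define w where "w = 1 / (2 + 2 * s)"
  have w: "w * (2 + 2 * s) = 1" and div: "x / (2 + 2 * s) = x * w" for x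
    unfolding w_def using pos by simp_all
  have X: "X = exp ((2 * a + p + (1 + 2 * s) * (q - r)) / (2 + 2 * s))"
  proof -
    have "X = exp ((2 * a + p) / (2 + 2 * s) + (1 + 2 * s) / (2 + 2 * s) * (q - r))"
      unfolding X_def ex
      by (simp add: powr_def exp_add[symmetric] exp_diff[symmetric] exp_double[symmetric])
    then show ?thesis by (simp only: times_divide_eq_left add_divide_distrib[symmetric])
  qed
  have R: "R = exp (4 * a / (2 + 2 * s) + 2 * s * q - 2 * s / (2 + 2 * s) * (p + r + q))"
  proof -
    define t where "t = p / (1 + 2 * s)"
    have p: "p = (1 + 2 * s) * t" unfolding t_def using pos by simp
    have "R = exp (4 * a / (2 + 2 * s) + 2 * s * q + 2 * s / (2 + 2 * s) * (t - (r + q)) - 2 * s * t)"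
      unfolding R_def ex t_def
      by (simp add: powr_def exp_add[symmetric] exp_diff[symmetric] exp_minus[symmetric])
    moreover have "2 * s / (2 + 2 * s) * (t - (r + q)) - 2 * s * t = - (2 * s / (2 + 2 * s) * (p + r + q))"
      unfolding p using pos by (simp add: field_simps)
    ultimately show ?thesis by (simp only: add_diff_eq[symmetric]) simp
  qed
  show "X\<^sup>2 * (B / l) / n \<le> R"
  proof -
    have 1: "X\<^sup>2 * (B / l) / n = exp (2 * ((2 * a + p + (1 + 2 * s) * (q - r)) / (2 + 2 * s)) + (r - q) - p)"
    proof -
      have "(exp w)\<^sup>2 * (exp r / exp q) / exp p = exp (2 * w + (r - q) - p)" for w
        by (simp add: exp_double exp_add exp_diff)
      then show ?thesis unfolding X ex .
    qed
    \<comment> \<open>The slack in the stochastic term is the factor l^(4s^2/(2+2s)), which is at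
      least 1.\<close>
    have 2: "4 * a / (2 + 2 * s) + 2 * s * q - 2 * s / (2 + 2 * s) * (p + r + q) - (2 * ((2 * a + p + (1 + 2 * s) * (q - r)) / (2 + 2 * s)) + (r - q) - p)
      = 4 * s\<^sup>2 / (2 + 2 * s) * q"
      unfolding div using w by algebra
    have 3: "4 * s\<^sup>2 / (2 + 2 * s) * q \<ge> 0" using q0 pos by simp
    show ?thesis unfolding R 1 exp_le_cancel_iff using 3 unfolding 2[symmetric] diff_ge_0_iff_ge .
  qed
  show "L\<^sup>2 * (X * l powr (- (2 * s / (2 + 2 * s))) * (B / l)) powr (- (2 * s)) = R"
  proof -
    have "L\<^sup>2 * (X * l powr (- (2 * s / (2 + 2 * s))) * (B / l)) powr (- (2 * s)) =
        exp (2 * a - 2 * s * ((2 * a + p + (1 + 2 * s) * (q - r)) / (2 + 2 * s) - 2 * s / (2 + 2 * s) * q + (r - q)))"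
      unfolding X ex by (simp add: powr_def exp_double[symmetric] exp_add[symmetric] exp_diff[symmetric] exp_minus[symmetric])
    moreover have "2 * a - 2 * s * ((2 * a + p + (1 + 2 * s) * (q - r)) / (2 + 2 * s) - 2 * s / (2 + 2 * s) * q + (r - q))
      = 4 * a / (2 + 2 * s) + 2 * s * q - 2 * s / (2 + 2 * s) * (p + r + q)"
      unfolding div using w by algebra
    ultimately show ?thesis unfolding R by simp
  qed
  show "1 \<le> X" if "B < n powr (1 / (1 + 2 * s)) / l" "1 / L \<le> l"
  proof -
    have "exp r < exp (p / (1 + 2 * s) - q)"
      using that(1) unfolding ex by (simp add: powr_def exp_diff)
    then have "(1 + 2 * s) * r \<le> (1 + 2 * s) * (p / (1 + 2 * s) - q)" using pos by simp
    then have "(1 + 2 * s) * r \<le> p - (1 + 2 * s) * q" using pos by (simp add: right_diff_distrib)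
    \<comment> \<open>The upper bound on B leaves 2(1+2s) ln l in the exponent of X; this offsets a
      negative 2 ln L once 1/L \<le> l.\<close>
    moreover have "exp (- a) \<le> exp q" using that(2) unfolding ex by (simp add: exp_minus inverse_eq_divide)
    moreover have "s * q \<ge> 0" using s q0 by simp
    ultimately have "2 * a + p + (1 + 2 * s) * (q - r) \<ge> 0" using q0 by (simp add: algebra_simps)
    then show ?thesis unfolding X using pos by simp
  qed
  show "L powr (- (2 / (2 + 2 * s))) * X * l powr (- (2 * s / (2 + 2 * s))) \<le> m"
    if "m > 0" "(n * l / m powr (2 + 2 * s)) powr (1 / (1 + 2 * s)) \<le> B"
  proof -
    define u where "u = ln m"
    have m: "m = exp u" using that by (simp add: u_def)
    have "exp ((p + q - (2 + 2 * s) * u) / (1 + 2 * s)) \<le> exp r"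
      using that(2) unfolding ex m by (simp add: powr_def exp_add[symmetric] exp_diff[symmetric])
    then have "p + q - (2 + 2 * s) * u \<le> (1 + 2 * s) * r" using pos by (simp add: field_simps)
    then have "(p + q - (1 + 2 * s) * r) / (2 + 2 * s) \<le> u" using pos by (simp add: field_simps)
    moreover have "L powr (- (2 / (2 + 2 * s))) * X * l powr (- (2 * s / (2 + 2 * s))) =
        exp (- (2 / (2 + 2 * s)) * a + (2 * a + p + (1 + 2 * s) * (q - r)) / (2 + 2 * s) - 2 * s / (2 + 2 * s) * q)"
      unfolding X ex by (simp add: powr_def exp_add[symmetric] exp_diff[symmetric])
    moreover have "- (2 / (2 + 2 * s)) * a + (2 * a + p + (1 + 2 * s) * (q - r)) / (2 + 2 * s) - 2 * s / (2 + 2 * s) * q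
        = (p + q - (1 + 2 * s) * r) / (2 + 2 * s)"
      unfolding div by (simp add: algebra_simps)
    ultimately show ?thesis unfolding m by simp
  qed
qed

theorem theorem2p5:
  fixes s L M \<sigma> :: real and N :: nat and \<psi> :: "nat \<Rightarrow> nat \<Rightarrow> real \<Rightarrow> real"
  assumes "s > 0" and "L > 0" and "M > 0" and "\<sigma> > 0"
    and "real N > s" and "cdv_basis N \<psi>"
  shows "\<exists>C>0. \<forall>\<^sub>F n in sequentially. \<forall>(m::nat) (B::real).
    1 \<le> m \<longrightarrow> m \<le> n \<longrightarrow> m dvd n \<longrightarrow>
    max ((real n * log 2 (real n) / real m powr (2 + 2 * s)) powr (1 / (1 + 2 * s)))
        (log 2 (real n)) \<le> B \<longrightarrow>
    B < real n powr (1 / (1 + 2 * s)) / log 2 (real n) \<longrightarrow>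
      dist_estimator \<psi> s L n m B \<in> dist_estimators n m \<sigma> (\<lambda>_. B) (besov_ball \<psi> s L) \<and>
      (SUP f0 \<in> {f \<in> besov_ball \<psi> s L. AE x in lborel. x \<in> {0..1} \<longrightarrow> \<bar>f x\<bar> \<le> M}.
         risk n m \<sigma> (dist_estimator \<psi> s L n m B) f0)
      \<le> ennreal (C * (L powr (4 / (2 + 2 * s)) * log 2 (real n) powr (2 * s)) *
           (real n powr (1 / (1 + 2 * s)) / (B * log 2 (real n))) powr (2 * s / (2 + 2 * s)) *
           real n powr (- (2 * s / (1 + 2 * s))))"
proof -
  have \<psi>: "orthonormal_basis_unit \<psi>" using assms(6) unfolding cdv_basis_def by blast
  note s = assms(1) and L = assms(2)
  define q where "q = (2::real) powr (- (2 * s))"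
  have q: "0 < q" "q < 1" unfolding q_def using s by (auto simp: powr_less_one)
  \<comment> \<open>A bound for the squared L2 norm on the Besov ball, obtained by summing all
    levels.\<close>
  define K where "K = L\<^sup>2 / (1 - q)"
  have K0: "K \<ge> 0" unfolding K_def using q by simp
  \<comment> \<open>The value 1/2 covers the loss from rounding X down, the power of L the loss from
    the cap m.\<close>
  define \<kappa> where "\<kappa> = min (1/2) (L powr (- (2 / (2 + 2 * s))))"
  have \<kappa>: "\<kappa> > 0" "\<kappa> \<le> 1/2" "\<kappa> \<le> L powr (- (2 / (2 + 2 * s)))" unfolding \<kappa>_def using L by auto
  define V where "V = 8 + 4 * (2 * M\<^sup>2 + 2 * \<sigma>\<^sup>2)"
  have V: "V > 0" unfolding V_def by (simp add: add_pos_nonneg)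
  \<comment> \<open>The first summand serves the stochastic error, the second the bias. In
    \<kappa>/4 one factor 1/2 is lost by rounding B/l down, the other by passing from \<eta> b to
    the power 2^J below it.\<close>
  define C where "C = V + (\<kappa> / 4) powr (- (2 * s)) / (1 - q)"
  have C: "C > 0" unfolding C_def using V q \<kappa> by (intro add_pos_nonneg) auto
  have main: "dist_estimator \<psi> s L n m B \<in> dist_estimators n m \<sigma> (\<lambda>_. B) (besov_ball \<psi> s L) \<and>
      (SUP f0 \<in> {f \<in> besov_ball \<psi> s L. AE x in lborel. x \<in> {0..1} \<longrightarrow> \<bar>f x\<bar> \<le> M}.
         risk n m \<sigma> (dist_estimator \<psi> s L n m B) f0)
      \<le> ennreal (C * (L powr (4 / (2 + 2 * s)) * log 2 (real n) powr (2 * s)) *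
           (real n powr (1 / (1 + 2 * s)) / (B * log 2 (real n))) powr (2 * s / (2 + 2 * s)) *
           real n powr (- (2 * s / (1 + 2 * s))))"
    \<comment> \<open>The meaning of large n: the first bound makes negative powers of the logarithm
      at most 1, the second gives X \<ge> 1, the third leaves room for the code overhead.\<close>
    if ln: "1 \<le> log 2 (real n)" "1 / L \<le> log 2 (real n)"
        "2 * (5 + 4 * ((K + 1) / 2 + \<sigma>)) \<le> log 2 (real n)"
      and m: "1 \<le> m" "m dvd n"
      and B: "max ((real n * log 2 (real n) / real m powr (2 + 2 * s)) powr (1 / (1 + 2 * s)))
        (log 2 (real n)) \<le> B" "B < real n powr (1 / (1 + 2 * s)) / log 2 (real n)"
    for n m :: nat and B :: real
  proof -
    define l where "l = log 2 (real n)"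
    define b where "b = block_size n B"
    define \<eta> where "\<eta> = num_groups s L n m B"
    define X where "X = (L\<^sup>2 * real n) powr (1 / (2 + 2 * s)) * (l / B) powr ((1 + 2 * s) / (2 + 2 * s))"
    define R where "R = L powr (4 / (2 + 2 * s)) * l powr (2 * s) *
      (real n powr (1 / (1 + 2 * s)) / (B * l)) powr (2 * s / (2 + 2 * s)) * real n powr (- (2 * s / (1 + 2 * s)))"
    define Y where "Y = X * l powr (- (2 * s / (2 + 2 * s))) * (B / l)"
    have l1: "l \<ge> 1" using ln l_def by simp
    have n: "n \<ge> 1" using ln by (cases n) (auto simp: log_def)
    have Bl: "B \<ge> l" "(real n * l / real m powr (2 + 2 * s)) powr (1 / (1 + 2 * s)) \<le> B"
      using B(1) unfolding l_def by auto
    have B0: "B > 0" using Bl l1 by simp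
    have npos: "real n > 0" and mpos: "real m > 0" using n m by auto
    note rate = rate_exponents[OF s L npos l1 B0, folded X_def R_def]
    have X1: "1 \<le> X" using rate(3) B(2) ln(2) l_def by simp
    have Xm: "L powr (- (2 / (2 + 2 * s))) * X * l powr (- (2 * s / (2 + 2 * s))) \<le> real m"
      using rate(4)[OF mpos] Bl(2) by simp
    have lp: "0 < l powr (- (2 * s / (2 + 2 * s)))" "l powr (- (2 * s / (2 + 2 * s))) \<le> 1"
      using l1 s powr_mono[of "- (2 * s / (2 + 2 * s))" 0 l] by auto
    have \<eta>_eq: "\<eta> = min (nat \<lfloor>X\<rfloor>) m" unfolding \<eta>_def num_groups_def X_def l_def ..
    have fX: "1 \<le> \<lfloor>X\<rfloor>" using X1 by simp
    have rX: "real (nat \<lfloor>X\<rfloor>) = of_int \<lfloor>X\<rfloor>" using fX by simp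
    have "1 \<le> nat \<lfloor>X\<rfloor>" using fX by linarith
    then have \<eta>1: "1 \<le> \<eta>" unfolding \<eta>_eq using m by simp
    have \<eta>X: "real \<eta> \<le> X" unfolding \<eta>_eq using rX by linarith
    \<comment> \<open>One lower bound for both branches of the minimum, so that no case distinction
      on the cap is needed later.\<close>
    have \<eta>_ge: "\<kappa> * X * l powr (- (2 * s / (2 + 2 * s))) \<le> real \<eta>"
    proof -
      have "\<kappa> * X * l powr (- (2 * s / (2 + 2 * s))) \<le> 1/2 * X * 1"
        using \<kappa> X1 lp by (intro mult_mono) auto
      also have "\<dots> \<le> of_int \<lfloor>X\<rfloor>" using half_le_floor[OF X1] by simp
      finally have "\<kappa> * X * l powr (- (2 * s / (2 + 2 * s))) \<le> real (nat \<lfloor>X\<rfloor>)" using rX by simp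
      moreover have "\<kappa> * X * l powr (- (2 * s / (2 + 2 * s))) \<le> real m"
        using \<kappa> X1 lp by (intro order_trans[OF _ Xm] mult_right_mono) auto
      ultimately show ?thesis unfolding \<eta>_eq by simp
    qed
    have Bl1: "1 \<le> B / l" using Bl l1 by simp
    then have fB: "1 \<le> \<lfloor>B / l\<rfloor>" by simp
    have rB: "real b = of_int \<lfloor>B / l\<rfloor>" unfolding b_def block_size_def l_def[symmetric] using fB by simp
    have b1: "1 \<le> b" unfolding b_def block_size_def l_def[symmetric] using fB by linarith
    have bB: "real b \<le> B / l" unfolding rB by simp
    have b_ge: "B / l / 2 \<le> real b" unfolding rB by (rule half_le_floor[OF Bl1])
    have Y0: "Y > 0" unfolding Y_def using X1 lp B0 l1 by simp
    have \<eta>b: "\<kappa> / 4 * Y \<le> real (\<eta> * b) / 2"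
    proof -
      have "(\<kappa> * X * l powr (- (2 * s / (2 + 2 * s)))) * (B / l / 2) \<le> real \<eta> * real b"
        using \<eta>_ge b_ge B0 l1 by (intro mult_mono) auto
      then show ?thesis by (simp add: Y_def mult_ac)
    qed
    have "1 \<le> \<eta> * b" using \<eta>1 b1 by simp
    \<comment> \<open>All levels below J are transmitted completely, since 2^j + k < 2^(j+1) \<le>
      2^J \<le> \<eta> b for j < J.\<close>
    then obtain J where J: "2 ^ J \<le> \<eta> * b" "\<eta> * b < 2 ^ (J + 1)" using ex_power_ivl1[of 2 "\<eta> * b"] by auto
    define T where "T = L\<^sup>2 * q ^ J / (1 - q)"
    have T0: "T \<ge> 0" unfolding T_def using q by simp
    have TR: "T \<le> (\<kappa> / 4) powr (- (2 * s)) / (1 - q) * R"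
    proof -
      have "real (\<eta> * b) < real (2 ^ (J + 1))" using J(2) by (simp only: of_nat_less_iff)
      then have J2: "real (\<eta> * b) / 2 \<le> 2 ^ J" by simp
      have "q ^ J = (2 ^ J) powr (- (2 * s))"
        unfolding q_def by (simp add: powr_realpow[symmetric] powr_powr mult.commute)
      \<comment> \<open>The exponent is negative, so the lower bound on 2^J becomes an upper
        bound.\<close>
      also have "\<dots> \<le> (\<kappa> / 4 * Y) powr (- (2 * s))"
        using s \<kappa> Y0 by (intro powr_mono2' order_trans[OF \<eta>b J2]) auto
      also have "\<dots> = (\<kappa> / 4) powr (- (2 * s)) * Y powr (- (2 * s))"
        by (rule powr_mult)
      finally have "L\<^sup>2 * q ^ J \<le> L\<^sup>2 * ((\<kappa> / 4) powr (- (2 * s)) * Y powr (- (2 * s)))"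
        by (rule mult_left_mono) simp
      also have "\<dots> = (\<kappa> / 4) powr (- (2 * s)) * R"
        using rate(2) unfolding Y_def[symmetric] by (simp add: mult_ac)
      finally show ?thesis unfolding T_def using q by (simp add: divide_right_mono)
    qed
    have VR: "real (\<eta> * b) * (V * real \<eta> / real n) \<le> V * R"
    proof -
      have "real \<eta> * real \<eta> * real b \<le> X * X * (B / l)"
        using \<eta>X bB X1 by (intro mult_mono) auto
      then have "V * (real \<eta> * real \<eta> * real b / real n) \<le> V * (X * X * (B / l) / real n)"
        using V by (intro mult_left_mono divide_right_mono) auto
      also have "\<dots> \<le> V * R"
        using rate(1) V by (intro mult_left_mono) (auto simp: power2_eq_square)
      finally show ?thesis by (simp add: mult_ac)
    qed
    have L2: "f \<in> L2_unit" and normK: "inner_unit f f \<le> K" if "f \<in> besov_ball \<psi> s L" for f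
      using that besov_ball_tail[OF \<psi> s that, of "{}" 0] by (auto simp: besov_ball_def K_def q_def)
    have mem: "dist_estimator \<psi> s L n m B \<in> dist_estimators n m \<sigma> (\<lambda>_. B) (besov_ball \<psi> s L)"
    proof (rule dist_estimator_mem[OF \<psi>])
      show "5 + 4 * ((K + 1) / 2 + \<sigma>) \<le> 1 / 2 * log 2 (real n)" using ln(3) by simp
    qed (use assms(4) n m b1 \<eta>1 B0 L2 normK K0 in \<open>auto simp: b_def \<eta>_def\<close>)
    have "risk n m \<sigma> (dist_estimator \<psi> s L n m B) f0 \<le> ennreal (C * R)"
      if f0: "f0 \<in> besov_ball \<psi> s L" "AE x in lborel. x \<in> {0..1} \<longrightarrow> \<bar>f0 x\<bar> \<le> M" for f0
    proof -
      have "inner_unit f0 f0 - (\<Sum>(j, k) | k < 2^j \<and> 2^j + k \<le> \<eta> * b. (inner_unit f0 (\<psi> j k))\<^sup>2) \<le> T"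
        unfolding T_def q_def
      proof (rule besov_ball_tail[OF \<psi> s f0(1) finite_index_pairs_upto])
        fix j k :: nat assume jk: "j < J" "k < 2^j"
        have "(2::nat) ^ (j + 1) \<le> 2 ^ J" using jk by (intro power_increasing) auto
        then show "(j, k) \<in> {(j, k). k < 2^j \<and> 2^j + k \<le> \<eta> * b}" using jk J(1) by simp
      qed
      then have "risk n m \<sigma> (dist_estimator \<psi> s L n m B) f0 \<le>
          ennreal (real (\<eta> * b) * (V * real \<eta> / real n) + T)"
        using dist_estimator_risk[OF \<psi> L2[OF f0(1)] f0(2) n m(2,1) _ _ T0] b1 \<eta>1
        unfolding b_def \<eta>_def V_def by blast
      also have "\<dots> \<le> ennreal (C * R)"
        using VR TR unfolding C_def by (intro ennreal_leI) (simp add: distrib_right)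
      finally show ?thesis .
    qed
    then have "(SUP f0 \<in> {f \<in> besov_ball \<psi> s L. AE x in lborel. x \<in> {0..1} \<longrightarrow> \<bar>f x\<bar> \<le> M}.
         risk n m \<sigma> (dist_estimator \<psi> s L n m B) f0) \<le> ennreal (C * R)"
      by (intro SUP_least) auto
    with mem show ?thesis unfolding R_def l_def by (simp only: mult.assoc)
  qed
  have "\<forall>\<^sub>F n in sequentially. c \<le> log 2 (real n)" for c
  proof -
    have "\<forall>\<^sub>F n in sequentially. 2 powr c \<le> real n"
      using filterlim_real_sequentially unfolding filterlim_at_top by blast
    then show ?thesis
    proof eventually_elim
      case (elim n)
      then have "0 < real n" by (rule less_le_trans[rotated]) simp
      then show ?case using elim by (simp add: le_log_iff)
    qed
  qed
  then have "\<forall>\<^sub>F n in sequentially. 1 \<le> log 2 (real n) \<and> 1 / L \<le> log 2 (real n) \<and>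
      2 * (5 + 4 * ((K + 1) / 2 + \<sigma>)) \<le> log 2 (real n)"
    by (intro eventually_conj)
  then show ?thesis
    by (intro exI[of _ C] conjI C, elim eventually_mono) (use main in blast)
qed

end
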